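(* Let $1\le p\le\infty$ and $n\ge1$. For every rational function $f\in\mathcal{R}_n$ having $n_1$ poles inside $\mathbb{D}$ and $n_2$ poles outside of $\overline{\mathbb{D}}$ (counting multiplicities), we have $$\|f'\|_{L^1}\le\Big(n_1^{1-\frac1p}\,\mathcal{D}_1^{\frac1p}(a)+n_2^{1-\frac1p}\,\mathcal{D}_2^{\frac1p}(a)\Big)\|f\|_{L^p},$$ where $a=\{a_k\}$ stands for the poles of $f$ (repeated counting multiplicities) and $$\mathcal{D}_1(a)=\sum_{|a_k|<1}\frac{1+|a_k|}{1-|a_k|},\qquad \mathcal{D}_2(a)=\sum_{|a_k|>1}\frac{|a_k|+1}{|a_k|-1}.$$
   Context: $\mathbb{D}$ is the open unit disc, $\mathbb{T}$ the unit circle, $m$ the normalized Lebesgue measure on $\mathbb{T}$, and $\|\cdot\|_{L^p}$ is the norm of $L^p(\mathbb{T},m)$. $\mathcal{P}_n$ is the space of complex polynomials of degree at most $n$, and $\mathcal{R}_n=\{P/Q:\ P,Q\in\mathcal{P}_n,\ Q(\xi)\ne0\text{ for }|\xi|=1\}$. Conventions: $1/p=0$ if $p=\infty$; empty sums are $0$; if $n_1=0$ (respectively $n_2=0$) the corresponding term on the right-hand side is $0$. Poles are taken in the extended complex plane $\mathbb{C}\cup\{\infty\}$: if $f=P/Q$ in lowest terms with $\deg P>\deg Q$, then $\infty$ is counted as a pole of multiplicity $\deg P-\deg Q$ outside $\overline{\mathbb{D}}$, and for $a_k=\infty$ the expression $\frac{|a_k|+1}{|a_k|-1}$ is understood as its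 limit $1$. *)

theory Defs
  imports
    "HOL-Complex_Analysis.Complex_Analysis"
    "HOL-Probability.Essential_Supremum"
    "HOL-Computational_Algebra.Polynomial_Factorial"
    "HOL-Computational_Algebra.Field_as_Ring"
begin

(* Pushing normalized Lebesgue measure on [0, 2 pi) forward along t |-> e^(it). *)
definition circle_measure :: "complex measure" where
  "circle_measure =
     distr (uniform_measure lborel {0..<2 * pi}) (restrict_space borel (sphere 0 1)) cis"

(* Real-valued, hence meaningful for g in L^p only; it is used below for functions
   that are continuous on the unit circle. *)
definition Lp_norm :: "ereal \<Rightarrow> (complex \<Rightarrow> complex) \<Rightarrow> real" where
  "Lp_norm p g =
     (if p = \<infinity> then real_of_ereal (esssup circle_measure (\<lambda>x. ereal (cmod (g x))))
      else (\<integral>x. cmod (g x) powr real_of_ereal p \<partial>circle_measure) powr (1 / real_of_ereal p))"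

definition rational_functions :: "nat \<Rightarrow> complex poly fract set" where
  "rational_functions n =
     {Fract P Q | P Q. degree P \<le> n \<and> degree Q \<le> n \<and> (\<forall>\<xi>. cmod \<xi> = 1 \<longrightarrow> poly Q \<xi> \<noteq> 0)}"

(* quot_of_fract yields numerator and denominator in lowest terms, so removable
   singularities of a representation P/Q play no role. *)
definition rat_eval :: "complex poly fract \<Rightarrow> complex \<Rightarrow> complex" where
  "rat_eval f z = poly (fst (quot_of_fract f)) z / poly (snd (quot_of_fract f)) z"

definition poles :: "complex poly fract \<Rightarrow> complex set" where
  "poles f = {z. is_pole (rat_eval f) z}"

definition pole_mult :: "complex poly fract \<Rightarrow> complex \<Rightarrow> nat" where
  "pole_mult f z = (if is_pole (rat_eval f) z then nat (- zorder (rat_eval f) z) else 0)"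

(* Truncated subtraction: 0 unless the numerator has the larger degree. *)
definition pole_mult_infinity :: "complex poly fract \<Rightarrow> nat" where
  "pole_mult_infinity f = degree (fst (quot_of_fract f)) - degree (snd (quot_of_fract f))"

definition num_poles_inside :: "complex poly fract \<Rightarrow> nat" where
  "num_poles_inside f = (\<Sum>a \<in> {a \<in> poles f. cmod a < 1}. pole_mult f a)"

definition num_poles_outside :: "complex poly fract \<Rightarrow> nat" where
  "num_poles_outside f = (\<Sum>a \<in> {a \<in> poles f. cmod a > 1}. pole_mult f a) + pole_mult_infinity f"

definition D1 :: "complex poly fract \<Rightarrow> real" where
  "D1 f = (\<Sum>a \<in> {a \<in> poles f. cmod a < 1}.
             real (pole_mult f a) * ((1 + cmod a) / (1 - cmod a)))"

(* A pole at infinity contributes 1, the limit of (|a| + 1) / (|a| - 1), per multiplicity. *)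
definition D2 :: "complex poly fract \<Rightarrow> real" where
  "D2 f = (\<Sum>a \<in> {a \<in> poles f. cmod a > 1}.
             real (pole_mult f a) * ((cmod a + 1) / (cmod a - 1)))
          + real (pole_mult_infinity f)"

end

theory Submission
  imports
    Defs
    "HOL-Probability.Probability_Measure"
    "HOL-Computational_Algebra.Fundamental_Theorem_Algebra"
begin

text \<open>
  Let \<open>B\<^sub>1\<close> be the Blaschke product whose zeros are the poles of \<open>f\<close> inside the disc and \<open>B\<^sub>2\<close> the one
  whose zeros are the reflections \<open>1 / cnj a\<close> of the poles outside (the pole at infinity is
  reflected to \<open>0\<close>). Multiplication by \<open>B\<^sub>1\<close> removes the poles inside, division by \<open>B\<^sub>2\<close> the poles outside.
  Everything follows from
  \[ \int |f'| \, dm \le \int |f| \, (|B_1'| + |B_2'|) \, dm , \]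
  because \<open>|B'|\<close> is on the circle a sum of Poisson kernels: its mean is the number of zeros, and it
  is pointwise at most the sum of the \<open>(1 + |a|) / (1 - |a|)\<close>. Interpolating between these two bounds
  by Hoelder's inequality gives the factors \<open>n\<^sub>i powr (1 - 1 / p) * D\<^sub>i powr (1 / p)\<close>.

  The inequality above comes from an integral representation of \<open>f'\<close>. For \<open>|z| = 1\<close>,
  \[ f'(z) = \int f(\zeta) \, \frac{(1 - B_2(z) / B_2(\zeta))^2 - (1 - B_1(\zeta) / B_1(z))^2}
       {(\zeta - z)^2} \, \zeta \, dm(\zeta) . \]
  After expanding the squares the constants \<open>1\<close> cancel, and what remains of the numerator times \<open>f\<close> is
  a function analytic on the closed disc plus a function analytic outside the open disc, together
  vanishing to second order at \<open>z\<close>; lemma \<open>double_pole_circle_mean\<close> evaluates all such integrals.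
  Since the Blaschke products are unimodular on the circle, the kernel is bounded by the sum over
  \<open>i = 1, 2\<close> of \<open>|B\<^sub>i(\<zeta>) - B\<^sub>i(z)|\<^sup>2 / |\<zeta> - z|\<^sup>2\<close>. This bound is symmetric in \<open>z\<close> and \<open>\<zeta>\<close>, and by
  the same lemma its mean in either variable is \<open>|B\<^sub>i'|\<close> at the other one
  (lemma \<open>blaschke_kernel_mean\<close>), so Tonelli's theorem finishes the argument.
\<close>

section \<open>Means over the unit circle\<close>

lemma circle_measure_eq_density:
  "circle_measure = distr (density lborel (\<lambda>t. ennreal (indicator {0..<2 * pi} t / (2 * pi))))
     (restrict_space borel (sphere 0 1)) cis"
proof -
  have "uniform_measure lborel {0..<2 * pi}
      = density lborel (\<lambda>t. ennreal (indicator {0..<2 * pi} t / (2 * pi)))"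
    unfolding uniform_measure_def
    by (rule arg_cong[where f = "density lborel"])
      (auto simp: fun_eq_iff divide_ennreal[symmetric] split: split_indicator)
  thus ?thesis by (simp add: circle_measure_def)
qed

lemma space_circle_measure [simp]: "space circle_measure = sphere 0 1"
  by (simp add: circle_measure_def space_restrict_space)

lemma sets_circle_measure [measurable_cong]:
  "sets circle_measure = sets (restrict_space borel (sphere 0 1))"
  by (simp add: circle_measure_def)

lemma measurable_cis [measurable]: "cis \<in> measurable borel (restrict_space borel (sphere 0 1))"
  by (rule measurable_restrict_space2)
    (auto intro!: borel_measurable_continuous_onI continuous_intros)

lemma prob_space_circle_measure: "prob_space circle_measure"
proof -
  have "prob_space (uniform_measure lborel {0..<2 * pi})"
    by (rule prob_space_uniform_measure) auto
  thus ?thesis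
    unfolding circle_measure_def
    by (rule prob_space.prob_space_distr) (auto intro: measurable_cis)
qed

lemma continuous_circle_measurable:
  fixes \<phi> :: "complex \<Rightarrow> 'b :: topological_space"
  assumes "continuous_on (sphere 0 1) \<phi>"
  shows "\<phi> \<in> borel_measurable circle_measure"
  using borel_measurable_continuous_on_restrict[OF assms]
  by (simp cong: measurable_cong_sets add: sets_circle_measure)

lemma continuous_circle_integrable:
  fixes \<phi> :: "complex \<Rightarrow> 'b :: {banach, second_countable_topology}"
  assumes "continuous_on (sphere 0 1) \<phi>"
  shows "integrable circle_measure \<phi>"
proof -
  interpret prob_space circle_measure by (rule prob_space_circle_measure)
  have "bounded (\<phi> ` sphere 0 1)"
    by (intro compact_imp_bounded compact_continuous_image assms compact_sphere)
  then obtain B where "\<forall>x\<in>sphere 0 1. norm (\<phi> x) \<le> B"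
    by (auto simp: bounded_iff)
  thus ?thesis
    by (intro integrable_const_bound[of _ B] continuous_circle_measurable assms AE_I2) auto
qed

text \<open>
  The kernels below have removable singularities at \<open>\<zeta> = z\<close>, where division by zero yields \<open>0\<close>
  instead of the limit; this lemma makes that irrelevant.
\<close>

lemma AE_circle_neq: "AE \<zeta> in circle_measure. \<zeta> \<noteq> z"
proof -
  have "AE t in lborel. t \<noteq> Arg2pi z"
    by (rule AE_lborel_singleton)
  hence "AE t in lborel. t \<in> {0..<2 * pi} \<longrightarrow> cis t \<noteq> z"
    by eventually_elim (auto dest: Arg2pi_unique[of 1, rotated 2] simp: cis_conv_exp)
  hence "AE t in uniform_measure lborel {0..<2 * pi}. cis t \<noteq> z"
    by (intro AE_uniform_measureI) auto
  moreover have "{\<zeta> \<in> space (restrict_space borel (sphere 0 1)). \<zeta> \<noteq> z}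
      \<in> sets (restrict_space borel (sphere 0 1))"
    by (subst sets_restrict_space_iff) (auto simp: space_restrict_space)
  ultimately show ?thesis
    unfolding circle_measure_def
    by (subst AE_distr_iff) simp_all
qed

lemma circle_mean_holomorphic:
  assumes "continuous_on (cball 0 1) \<phi>" "\<phi> holomorphic_on ball 0 1"
  shows "has_bochner_integral circle_measure \<phi> (\<phi> 0)"
proof -
  have cont: "continuous_on (sphere 0 1) \<phi>"
    by (rule continuous_on_subset[OF assms(1)]) auto
  have "((\<lambda>u. \<phi> u / (u - 0)) has_contour_integral (2 * of_real pi * \<i> * \<phi> 0)) (circlepath 0 1)"
    by (rule Cauchy_integral_circlepath) (use assms in auto)
  hence "((\<lambda>t. \<phi> (cis t) / cis t * \<i> * cis t) has_integral (2 * of_real pi * \<i> * \<phi> 0)) {0..2 * pi}"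
    unfolding circlepath_def
    by (subst (asm) has_contour_integral_part_circlepath_iff) auto
  hence "((\<lambda>t. (1 / \<i>) * (\<phi> (cis t) / cis t * \<i> * cis t)) has_integral
      (1 / \<i>) * (2 * of_real pi * \<i> * \<phi> 0)) {0..2 * pi}"
    by (rule has_integral_mult_right)
  hence int: "((\<lambda>t. \<phi> (cis t)) has_integral (2 * of_real pi * \<phi> 0)) {0..2 * pi}"
    by (simp add: field_simps)
  have cont': "continuous_on {0..2 * pi} (\<lambda>t. \<phi> (cis t))"
    by (rule continuous_on_compose2[OF cont]) (auto intro!: continuous_intros)
  have si: "set_integrable lborel {0..2 * pi} (\<lambda>t. \<phi> (cis t))"
    by (rule borel_integrable_atLeastAtMost'[OF cont'])
  have "(LINT t:{0..2 * pi}|lborel. \<phi> (cis t)) = 2 * of_real pi * \<phi> 0"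
    using set_borel_integral_eq_integral(2)[OF si] int by (simp add: integral_unique)
  hence "has_bochner_integral lborel (\<lambda>t. indicator {0..2 * pi} t *\<^sub>R \<phi> (cis t)) (2 * of_real pi * \<phi> 0)"
    using si by (simp add: has_bochner_integral_iff set_integrable_def set_lebesgue_integral_def)
  from has_bochner_integral_scaleR_right[OF this, of "1 / (2 * pi)"]
  have *: "has_bochner_integral lborel
      (\<lambda>t. (1 / (2 * pi)) *\<^sub>R (indicator {0..2 * pi} t *\<^sub>R \<phi> (cis t))) (\<phi> 0)"
    by (simp add: scaleR_conv_of_real)
  have meas: "(\<lambda>t. \<phi> (cis t)) \<in> borel_measurable lborel"
    using measurable_compose[OF measurable_cis borel_measurable_continuous_on_restrict[OF cont]]
    by simp
  have "has_bochner_integral lborel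
      (\<lambda>t. (indicator {0..<2 * pi} t / (2 * pi)) *\<^sub>R \<phi> (cis t)) (\<phi> 0)"
  proof (rule has_bochner_integralI_AE[OF *])
    show "(\<lambda>t. (indicator {0..<2 * pi} t / (2 * pi)) *\<^sub>R \<phi> (cis t)) \<in> borel_measurable lborel"
      using meas by measurable
    show "AE t in lborel. (1 / (2 * pi)) *\<^sub>R (indicator {0..2 * pi} t *\<^sub>R \<phi> (cis t)) =
        (indicator {0..<2 * pi} t / (2 * pi)) *\<^sub>R \<phi> (cis t)"
      using AE_lborel_singleton[of "2 * pi"]
      by eventually_elim (auto split: split_indicator)
  qed
  hence "has_bochner_integral (density lborel (\<lambda>t. ennreal (indicator {0..<2 * pi} t / (2 * pi))))
      (\<lambda>t. \<phi> (cis t)) (\<phi> 0)"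
    using meas by (subst has_bochner_integral_density) auto
  thus ?thesis
    unfolding circle_measure_eq_density
    by (intro has_bochner_integral_distr borel_measurable_continuous_on_restrict cont)
      (auto intro: measurable_cis)
qed

lemma cnj_eq_inverse_circle: "norm \<zeta> = 1 \<Longrightarrow> cnj \<zeta> = 1 / \<zeta>"
  using complex_norm_square[of \<zeta>] by (cases "\<zeta> = 0") (auto simp: field_simps)

text \<open>
  On the circle \<open>1 / \<zeta>\<close> is \<open>cnj \<zeta>\<close>, and \<open>cnj \<circ> \<phi> \<circ> cnj\<close> is again analytic, so this is the conjugate
  of the mean value property. It handles functions analytic outside the disc without
  contours around infinity.
\<close>

lemma circle_mean_holomorphic_inverse:
  assumes "continuous_on (cball 0 1) \<phi>" "\<phi> holomorphic_on ball 0 1"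
  shows "has_bochner_integral circle_measure (\<lambda>\<zeta>. \<phi> (1 / \<zeta>)) (\<phi> 0)"
proof -
  have "cnj ` ball 0 1 = ball 0 1"
    by (auto simp: image_cnj_conv_vimage_cnj)
  hence holo: "(cnj \<circ> \<phi> \<circ> cnj) holomorphic_on ball 0 1"
    by (intro holomorphic_on_compose_cnj_cnj) (use assms in auto)
  have cont: "continuous_on (cball 0 1) (cnj \<circ> \<phi> \<circ> cnj)"
    unfolding o_def
    by (intro continuous_on_cnj continuous_on_compose2[OF assms(1)] continuous_intros) auto
  from circle_mean_holomorphic[OF cont holo]
  have "has_bochner_integral circle_measure (\<lambda>\<zeta>. cnj (cnj (\<phi> (cnj \<zeta>)))) (cnj (cnj (\<phi> (cnj 0))))"
    by (subst has_bochner_integral_cnj) (auto simp: o_def)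
  thus ?thesis
    by (subst has_bochner_integral_cong[of _ circle_measure, OF refl _ refl,
          where g = "\<lambda>\<zeta>. cnj (cnj (\<phi> (cnj \<zeta>)))"]) (auto simp: cnj_eq_inverse_circle)
qed

lemma analytic_second_order_expansion:
  assumes "F analytic_on S" "z \<in> S"
  obtains T where "T analytic_on S"
    "\<And>\<zeta>. \<zeta> \<in> S \<Longrightarrow> F \<zeta> = F z + deriv F z * (\<zeta> - z) + (\<zeta> - z)\<^sup>2 * T \<zeta>"
proof -
  obtain U where U: "open U" "S \<subseteq> U" "F holomorphic_on U"
    using assms(1) by (auto simp: analytic_on_holomorphic)
  define T1 where "T1 = (\<lambda>\<zeta>. if \<zeta> = z then deriv F z else (F \<zeta> - F z) / (\<zeta> - z))"
  define T2 where "T2 = (\<lambda>\<zeta>. if \<zeta> = z then deriv T1 z else (T1 \<zeta> - T1 z) / (\<zeta> - z))"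
  have "T1 holomorphic_on U"
    unfolding T1_def by (rule pole_lemma_open) (use U in auto)
  hence "T2 holomorphic_on U"
    unfolding T2_def by (rule pole_lemma_open) (use U in auto)
  hence "T2 analytic_on S"
    using U by (auto simp: analytic_on_holomorphic)
  moreover have "F \<zeta> = F z + deriv F z * (\<zeta> - z) + (\<zeta> - z)\<^sup>2 * T2 \<zeta>" for \<zeta>
  proof -
    have 1: "F \<zeta> = F z + (\<zeta> - z) * T1 \<zeta>" and 2: "T1 \<zeta> = T1 z + (\<zeta> - z) * T2 \<zeta>"
      by (simp_all add: T1_def T2_def)
    have "T1 z = deriv F z" by (simp add: T1_def)
    thus ?thesis
      using 1 unfolding 2 by (simp add: algebra_simps power2_eq_square)
  qed
  ultimately show ?thesis using that by blast
qed

text \<open>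
  The basic integral formula. Functions analytic outside the open disc are written as \<open>g (1 / \<zeta>)\<close>
  with \<open>g\<close> analytic on the closed disc; the last two hypotheses say that \<open>F \<zeta> + g (1 / \<zeta>)\<close> vanishes to
  second order at \<open>z\<close>, so that the integrand is regular on the circle. Subtracting from \<open>F\<close> and from \<open>g\<close>
  their Taylor polynomials of degree one at \<open>z\<close> and \<open>1 / z\<close> leaves remainders that stay
  analytic after division by the double pole and whose means vanish by the mean value property; the
  Taylor polynomials themselves contribute the constant \<open>deriv F z\<close>.
\<close>

lemma double_pole_circle_mean:
  assumes F: "F analytic_on cball 0 1" and g: "g analytic_on cball 0 1" and z: "norm z = 1"
    and sum0: "F z + g (1 / z) = 0" and deriv_eq: "deriv g (1 / z) = deriv F z * z\<^sup>2"
  shows "has_bochner_integral circle_measure (\<lambda>\<zeta>. \<zeta> * (F \<zeta> + g (1 / \<zeta>)) / (\<zeta> - z)\<^sup>2) (deriv F z)"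
proof -
  have z0: "z \<noteq> 0" using z by auto
  obtain T where T: "T analytic_on cball 0 1"
    "\<And>\<zeta>. \<zeta> \<in> cball 0 1 \<Longrightarrow> F \<zeta> = F z + deriv F z * (\<zeta> - z) + (\<zeta> - z)\<^sup>2 * T \<zeta>"
    using analytic_second_order_expansion[OF F, of z] z by auto
  obtain S where S: "S analytic_on cball 0 1"
    "\<And>w. w \<in> cball 0 1 \<Longrightarrow>
        g w = g (1 / z) + deriv g (1 / z) * (w - 1 / z) + (w - 1 / z)\<^sup>2 * S w"
    using analytic_second_order_expansion[OF g, of "1 / z"] z by (auto simp: norm_divide)
  have "(\<lambda>\<zeta>. deriv F z + \<zeta> * T \<zeta>) analytic_on cball 0 1"
    by (intro analytic_intros T)
  hence 1: "has_bochner_integral circle_measure (\<lambda>\<zeta>. deriv F z + \<zeta> * T \<zeta>) (deriv F z + 0 * T 0)"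
    by (intro circle_mean_holomorphic holomorphic_on_imp_continuous_on
          analytic_imp_holomorphic) (auto elim: analytic_on_subset)
  have "(\<lambda>w. w * S w / z\<^sup>2) analytic_on cball 0 1"
    by (intro analytic_intros S) (use z0 in auto)
  hence 2: "has_bochner_integral circle_measure (\<lambda>\<zeta>. (1 / \<zeta>) * S (1 / \<zeta>) / z\<^sup>2) (0 * S 0 / z\<^sup>2)"
    by (intro circle_mean_holomorphic_inverse[where \<phi> = "\<lambda>w. w * S w / z\<^sup>2"]
          holomorphic_on_imp_continuous_on analytic_imp_holomorphic)
      (auto elim: analytic_on_subset)
  have 3: "has_bochner_integral circle_measure
      (\<lambda>\<zeta>. (deriv F z + \<zeta> * T \<zeta>) + (1 / \<zeta>) * S (1 / \<zeta>) / z\<^sup>2) (deriv F z)"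
    using has_bochner_integral_add[OF 1 2] by simp
  show ?thesis
  proof (rule has_bochner_integralI_AE[OF 3])
    have "continuous_on (cball 0 1) F" "continuous_on (cball 0 1) g"
      using F g by (auto intro!: holomorphic_on_imp_continuous_on analytic_imp_holomorphic)
    hence cF: "continuous_on (sphere 0 1) F" and cg: "continuous_on (sphere 0 1) g"
      by (auto elim: continuous_on_subset)
    have "continuous_on (sphere 0 1) (\<lambda>\<zeta>. g (1 / \<zeta>))"
      by (rule continuous_on_compose2[OF cg]) (auto intro!: continuous_intros simp: norm_divide)
    with cF have "continuous_on (sphere 0 1) (\<lambda>\<zeta>. \<zeta> * (F \<zeta> + g (1 / \<zeta>)))"
      by (intro continuous_on_mult continuous_on_add continuous_on_id)
    from continuous_circle_measurable[OF this]
    show "(\<lambda>\<zeta>. \<zeta> * (F \<zeta> + g (1 / \<zeta>)) / (\<zeta> - z)\<^sup>2) \<in> borel_measurable circle_measure"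
      by (rule borel_measurable_divide) (auto intro!: continuous_circle_measurable continuous_intros)
    show "AE \<zeta> in circle_measure. deriv F z + \<zeta> * T \<zeta> + 1 / \<zeta> * S (1 / \<zeta>) / z\<^sup>2 =
          \<zeta> * (F \<zeta> + g (1 / \<zeta>)) / (\<zeta> - z)\<^sup>2"
      using AE_circle_neq[of z] AE_space
    proof eventually_elim
      fix \<zeta> assume \<zeta>: "\<zeta> \<noteq> z" "\<zeta> \<in> space circle_measure"
      hence \<zeta>0: "\<zeta> \<noteq> 0" and n: "norm \<zeta> = 1" by auto
      have gz: "g (1 / z) = - F z" using sum0 by (simp add: eq_neg_iff_add_eq_0 add.commute)
      \<comment> \<open>In the coordinate \<open>1 / \<zeta>\<close> the double pole at \<open>1 / z\<close> is, up to units, the double pole at \<open>z\<close>.\<close>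
      have d: "1 / \<zeta> - 1 / z = - (\<zeta> - z) / (\<zeta> * z)"
        using \<zeta>0 z0 by (simp add: field_simps)
      have F': "F \<zeta> = F z + deriv F z * (\<zeta> - z) + (\<zeta> - z)\<^sup>2 * T \<zeta>"
        using n by (intro T) auto
      have "g (1 / \<zeta>) = - F z + deriv F z * z\<^sup>2 * (1 / \<zeta> - 1 / z) + (1 / \<zeta> - 1 / z)\<^sup>2 * S (1 / \<zeta>)"
        using S(2)[of "1 / \<zeta>"] n by (simp add: norm_divide gz deriv_eq)
      also have "\<dots> = - F z - deriv F z * (\<zeta> - z) * (z / \<zeta>) + (\<zeta> - z)\<^sup>2 * (S (1 / \<zeta>) / (\<zeta> * z)\<^sup>2)"
      proof -
        have a1: "deriv F z * z\<^sup>2 * (- x / (\<zeta> * z)) = - (deriv F z * x * (z / \<zeta>))" for x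
          using z0 by (simp add: power2_eq_square)
        have a2: "(- x / (\<zeta> * z))\<^sup>2 * S (1 / \<zeta>) = x\<^sup>2 * (S (1 / \<zeta>) / (\<zeta> * z)\<^sup>2)" for x
          by (simp only: power_divide power2_minus times_divide_eq_left times_divide_eq_right)
        show ?thesis unfolding d a1 a2 by simp
      qed
      finally have g': "g (1 / \<zeta>) = \<dots>" .
      have "F \<zeta> + g (1 / \<zeta>) = deriv F z * ((\<zeta> - z) * (1 - z / \<zeta>))
          + (\<zeta> - z)\<^sup>2 * (T \<zeta> + S (1 / \<zeta>) / (\<zeta> * z)\<^sup>2)"
      proof -
        have "a + c * x + y * t + (- a - c * x * r + y * s) = c * (x * (1 - r)) + y * (t + s)"
          for a c x y t r s :: complex by (simp add: algebra_simps)
        thus ?thesis unfolding F' g' .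
      qed
      also have "(\<zeta> - z) * (1 - z / \<zeta>) = (\<zeta> - z)\<^sup>2 / \<zeta>"
      proof -
        have "1 - z / \<zeta> = (\<zeta> - z) / \<zeta>" using \<zeta>0 by (simp add: diff_divide_distrib)
        thus ?thesis by (simp add: power2_eq_square)
      qed
      finally have "\<zeta> * (F \<zeta> + g (1 / \<zeta>)) = \<zeta> * (deriv F z * ((\<zeta> - z)\<^sup>2 / \<zeta>)
          + (\<zeta> - z)\<^sup>2 * (T \<zeta> + S (1 / \<zeta>) / (\<zeta> * z)\<^sup>2))" by (simp only:)
      also have "\<dots> = (deriv F z + \<zeta> * T \<zeta> + 1 / \<zeta> * S (1 / \<zeta>) / z\<^sup>2) * (\<zeta> - z)\<^sup>2"
      proof -
        have "\<zeta> * (S (1 / \<zeta>) / (\<zeta> * z)\<^sup>2) = 1 / \<zeta> * S (1 / \<zeta>) / z\<^sup>2"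
          using \<zeta>0 by (simp add: power2_eq_square)
        moreover have "\<zeta> * (c * (x / \<zeta>) + x * (t + s)) = (c + \<zeta> * t + \<zeta> * s) * x" for c x t s
          using \<zeta>0 by (simp add: distrib_left distrib_right mult_ac)
        ultimately show ?thesis by (simp only:)
      qed
      finally have "\<zeta> * (F \<zeta> + g (1 / \<zeta>)) = \<dots>" .
      moreover have "(\<zeta> - z)\<^sup>2 \<noteq> 0" using \<zeta>(1) by simp
      ultimately show "deriv F z + \<zeta> * T \<zeta> + 1 / \<zeta> * S (1 / \<zeta>) / z\<^sup>2 =
          \<zeta> * (F \<zeta> + g (1 / \<zeta>)) / (\<zeta> - z)\<^sup>2"
        by (metis nonzero_mult_div_cancel_right)
    qed
  qed
qed

section \<open>Blaschke products and their difference kernel\<close>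

text \<open>
  Zeros and multiplicities are given as an indexed family, so that the zeros belonging to outside
  poles can be indexed by the poles themselves.
\<close>

definition blaschke :: "'i set \<Rightarrow> ('i \<Rightarrow> nat) \<Rightarrow> ('i \<Rightarrow> complex) \<Rightarrow> complex \<Rightarrow> complex" where
  "blaschke I m \<alpha> \<zeta> = (\<Prod>i\<in>I. ((\<zeta> - \<alpha> i) / (1 - cnj (\<alpha> i) * \<zeta>)) ^ m i)"

text \<open>
  On the unit circle this is \<open>|B'|\<close> for \<open>B = blaschke I m \<alpha>\<close>, by lemma \<open>blaschke_deriv\<close>.
\<close>

definition poisson_sum :: "'i set \<Rightarrow> ('i \<Rightarrow> nat) \<Rightarrow> ('i \<Rightarrow> complex) \<Rightarrow> complex \<Rightarrow> real" where
  "poisson_sum I m \<alpha> \<zeta> = (\<Sum>i\<in>I. real (m i) * ((1 - (norm (\<alpha> i))\<^sup>2) / (norm (\<zeta> - \<alpha> i))\<^sup>2))"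

lemma one_minus_cnj_mult_neq_0:
  assumes "norm a < 1" "norm \<zeta> \<le> 1"
  shows "1 - cnj a * \<zeta> \<noteq> 0"
proof
  assume "1 - cnj a * \<zeta> = 0"
  hence "norm (cnj a * \<zeta>) = 1" by simp
  moreover have "norm (cnj a * \<zeta>) \<le> norm a * 1"
    using assms by (simp add: norm_mult mult_left_le)
  ultimately show False using assms by simp
qed

lemma one_minus_cnj_mult_circle:
  assumes "norm \<zeta> = 1"
  shows "1 - cnj a * \<zeta> = \<zeta> * cnj (\<zeta> - a)"
proof -
  have "\<zeta> * cnj \<zeta> = 1"
    using complex_norm_square[of \<zeta>] assms by simp
  thus ?thesis by (simp add: right_diff_distrib mult.commute)
qed

lemma blaschke_analytic:
  assumes "\<And>i. i \<in> I \<Longrightarrow> norm (\<alpha> i) < 1"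
  shows "blaschke I m \<alpha> analytic_on cball 0 1"
  unfolding blaschke_def
  by (intro analytic_intros) (use one_minus_cnj_mult_neq_0 assms in auto)

lemma blaschke_norm:
  assumes "\<And>i. i \<in> I \<Longrightarrow> norm (\<alpha> i) < 1" "norm \<zeta> = 1"
  shows "norm (blaschke I m \<alpha> \<zeta>) = 1"
proof -
  have "norm ((\<zeta> - \<alpha> i) / (1 - cnj (\<alpha> i) * \<zeta>)) = 1" if "i \<in> I" for i
  proof -
    have "1 - cnj (\<alpha> i) * \<zeta> = \<zeta> * cnj (\<zeta> - \<alpha> i)"
      by (rule one_minus_cnj_mult_circle[OF assms(2)])
    hence "norm (1 - cnj (\<alpha> i) * \<zeta>) = norm (\<zeta> - \<alpha> i)"
      using assms(2) by (simp add: norm_mult del: complex_cnj_diff)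
    moreover have "\<zeta> \<noteq> \<alpha> i" using assms that by force
    ultimately show ?thesis by (simp add: norm_divide)
  qed
  thus ?thesis unfolding blaschke_def prod_norm[symmetric] norm_power by simp
qed

lemma blaschke_cnj: "blaschke I m (\<lambda>i. cnj (\<alpha> i)) \<zeta> = cnj (blaschke I m \<alpha> (cnj \<zeta>))"
  by (simp add: blaschke_def)

text \<open>
  By Schwarz reflection \<open>1 / B\<close> is, as a function of \<open>1 / \<zeta>\<close>, the Blaschke product with conjugate
  zeros. It is therefore a function analytic outside the disc, in the form in which
  \<open>double_pole_circle_mean\<close> accepts it.
\<close>

lemma blaschke_inverse:
  assumes "\<And>i. i \<in> I \<Longrightarrow> norm (\<alpha> i) < 1" "norm \<zeta> = 1"
  shows "blaschke I m (\<lambda>i. cnj (\<alpha> i)) (1 / \<zeta>) = 1 / blaschke I m \<alpha> \<zeta>"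
proof -
  have "norm (blaschke I m \<alpha> \<zeta>) = 1"
    by (rule blaschke_norm) (use assms in auto)
  thus ?thesis
    unfolding cnj_eq_inverse_circle[OF assms(2), symmetric] blaschke_cnj complex_cnj_cnj
    by (rule cnj_eq_inverse_circle)
qed

lemma poisson_sum_cnj:
  assumes "norm z = 1"
  shows "poisson_sum I m (\<lambda>i. cnj (\<alpha> i)) (1 / z) = poisson_sum I m \<alpha> z"
proof -
  have "norm (cnj z - cnj (\<alpha> i)) = norm (z - \<alpha> i)" for i
    by (metis complex_cnj_diff complex_mod_cnj)
  thus ?thesis
    unfolding cnj_eq_inverse_circle[OF assms, symmetric] poisson_sum_def complex_mod_cnj
    by simp
qed

text \<open>
  Apart from the factor \<open>z\<close>, the right-hand side is the logarithmic derivative of the Blaschke factor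
  with zero \<open>a\<close>; it also exhibits the Poisson kernel as a function analytic outside the disc plus one
  analytic inside, from which its mean can be read off.
\<close>

lemma circle_poisson_kernel_eq:
  assumes "norm a < 1" "norm z = 1"
  shows "complex_of_real ((1 - (norm a)\<^sup>2) / (norm (z - a))\<^sup>2) = z / (z - a) + cnj a * z / (1 - cnj a * z)"
proof -
  have z0: "z \<noteq> 0" and za: "z \<noteq> a" using assms by auto
  have e: "1 - cnj a * z = z * cnj (z - a)"
    by (rule one_minus_cnj_mult_circle[OF assms(2)])
  have ne: "cnj (z - a) \<noteq> 0" using za by simp
  have "z / (z - a) + cnj a * z / (1 - cnj a * z) = z / (z - a) + cnj a / cnj (z - a)"
    unfolding e using z0 by simp
  also have "\<dots> = (z * cnj (z - a) + cnj a * (z - a)) / ((z - a) * cnj (z - a))"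
    using za ne by (subst add_frac_eq) (auto simp: mult.commute)
  also have "z * cnj (z - a) + cnj a * (z - a) = 1 - a * cnj a"
  proof -
    have "z * cnj (z - a) + cnj a * (z - a) = (1 - cnj a * z) + cnj a * (z - a)"
      by (simp only: e)
    thus ?thesis by (simp add: right_diff_distrib mult.commute)
  qed
  finally show ?thesis
    by (simp only: of_real_divide of_real_diff of_real_1 complex_norm_square)
qed

lemma blaschke_deriv:
  assumes "\<And>i. i \<in> I \<Longrightarrow> norm (\<alpha> i) < 1" "norm z = 1"
  shows "(blaschke I m \<alpha> has_field_derivative
           blaschke I m \<alpha> z * of_real (poisson_sum I m \<alpha> z) / z) (at z)"
proof -
  have z0: "z \<noteq> 0" using assms by auto
  define c where "c i = complex_of_real ((1 - (norm (\<alpha> i))\<^sup>2) / (norm (z - \<alpha> i))\<^sup>2)" for i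
  define d where "d i = ((z - \<alpha> i) / (1 - cnj (\<alpha> i) * z)) ^ m i / z * (of_nat (m i) * c i)" for i
  have nz: "z - \<alpha> i \<noteq> 0" "1 - cnj (\<alpha> i) * z \<noteq> 0" if "i \<in> I" for i
    using assms that one_minus_cnj_mult_neq_0[of "\<alpha> i" z] by force+
  have "((\<lambda>u. ((u - \<alpha> i) / (1 - cnj (\<alpha> i) * u)) ^ m i) has_field_derivative d i) (at z)"
    if i: "i \<in> I" for i
  proof (cases "m i")
    case 0
    thus ?thesis by (auto simp: d_def)
  next
    case (Suc k)
    define x y where "x = z - \<alpha> i" and "y = 1 - cnj (\<alpha> i) * z"
    have xy: "x \<noteq> 0" "y \<noteq> 0" using nz[OF i] by (auto simp: x_def y_def)
    have ci: "c i = z / x + cnj (\<alpha> i) * z / y"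
      unfolding c_def x_def y_def
      using circle_poisson_kernel_eq[OF assms(1)[OF i] assms(2)] by simp
    have "((\<lambda>u. (u - \<alpha> i) / (1 - cnj (\<alpha> i) * u)) has_field_derivative
        (y + x * cnj (\<alpha> i)) / (y * y)) (at z)"
      using nz[OF i] by (auto intro!: derivative_eq_intros simp: x_def y_def)
    also have "(y + x * cnj (\<alpha> i)) / (y * y) = x / y / z * c i"
      unfolding ci using xy z0 by (simp add: distrib_left add_divide_distrib)
    finally have q: "((\<lambda>u. (u - \<alpha> i) / (1 - cnj (\<alpha> i) * u)) has_field_derivative x / y / z * c i) (at z)" .
    have "((\<lambda>u. ((u - \<alpha> i) / (1 - cnj (\<alpha> i) * u)) ^ m i) has_field_derivative
       of_nat (m i) * (x / y / z * c i * (x / y) ^ k)) (at z)"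
      using DERIV_power[OF q, of "m i"] by (simp only: Suc One_nat_def diff_Suc_Suc diff_zero x_def y_def)
    also have "of_nat (m i) * (x / y / z * c i * (x / y) ^ k) = d i"
      unfolding d_def x_def[symmetric] y_def[symmetric] Suc by (simp only: power_Suc) simp
    finally show ?thesis .
  qed
  from has_field_derivative_prod'[OF _ this, of I]
  have "(blaschke I m \<alpha> has_field_derivative blaschke I m \<alpha> z *
     (\<Sum>i\<in>I. d i / ((z - \<alpha> i) / (1 - cnj (\<alpha> i) * z)) ^ m i)) (at z)"
    using nz by (auto simp: blaschke_def[abs_def])
  also have "(\<Sum>i\<in>I. d i / ((z - \<alpha> i) / (1 - cnj (\<alpha> i) * z)) ^ m i) = of_real (poisson_sum I m \<alpha> z) / z"
    unfolding poisson_sum_def of_real_sum sum_divide_distrib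
    by (intro sum.cong refl) (use nz in \<open>simp add: d_def c_def\<close>)
  finally show ?thesis by simp
qed

text \<open>
  For unimodular \<open>u\<close> and \<open>v\<close> one has \<open>|u - v|\<^sup>2 = - (u - v)\<^sup>2 / (u * v)\<close>. Applied to numerator and
  denominator this turns the kernel into the integrand of \<open>double_pole_circle_mean\<close> with
  \<open>- z * (1 - B \<zeta> / B z)\<close> as the inner and \<open>- z * (1 - B z / B \<zeta>)\<close> as the outer part. The result is
  \<open>z * deriv B z / B z\<close>.
\<close>

lemma blaschke_kernel_mean:
  fixes \<alpha> :: "'i \<Rightarrow> complex" and m :: "'i \<Rightarrow> nat"
  assumes \<alpha>: "\<And>i. i \<in> I \<Longrightarrow> norm (\<alpha> i) < 1" and z: "norm z = 1"
  defines "B \<equiv> blaschke I m \<alpha>"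
  shows "has_bochner_integral circle_measure
     (\<lambda>\<zeta>. (norm (B \<zeta> - B z))\<^sup>2 / (norm (\<zeta> - z))\<^sup>2) (poisson_sum I m \<alpha> z)"
proof -
  define C where "C = blaschke I m (\<lambda>i. cnj (\<alpha> i))"
  define F where "F = (\<lambda>\<zeta>. - z * (1 - B \<zeta> / B z))"
  define g where "g = (\<lambda>w. - z * (1 - C w * B z))"
  have z0: "z \<noteq> 0" using z by auto
  have nB: "norm (B \<zeta>) = 1" "B \<zeta> \<noteq> 0" if "norm \<zeta> = 1" for \<zeta>
  proof -
    show "norm (B \<zeta>) = 1" unfolding B_def by (rule blaschke_norm) (use \<alpha> that in auto)
    thus "B \<zeta> \<noteq> 0" by auto
  qed
  have C: "C (1 / \<zeta>) = 1 / B \<zeta>" if "norm \<zeta> = 1" for \<zeta>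
    unfolding C_def B_def by (rule blaschke_inverse) (use \<alpha> that in auto)
  have F_deriv: "(F has_field_derivative of_real (poisson_sum I m \<alpha> z)) (at z)"
    unfolding F_def B_def using nB(2)[OF z] z0
    by (auto intro!: derivative_eq_intros blaschke_deriv \<alpha> z simp: B_def)
  have "(C has_field_derivative C (1 / z) * of_real (poisson_sum I m \<alpha> z) / (1 / z)) (at (1 / z))"
    using blaschke_deriv[of I "\<lambda>i. cnj (\<alpha> i)" "1 / z" m] \<alpha> z poisson_sum_cnj[OF z, of I m \<alpha>]
    by (simp add: C_def norm_divide)
  hence g_deriv: "(g has_field_derivative of_real (poisson_sum I m \<alpha> z) * z\<^sup>2) (at (1 / z))"
    unfolding g_def using nB(2)[OF z] z0
    by (auto intro!: derivative_eq_intros simp: C[OF z] power2_eq_square)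
  have "has_bochner_integral circle_measure (\<lambda>\<zeta>. \<zeta> * (F \<zeta> + g (1 / \<zeta>)) / (\<zeta> - z)\<^sup>2) (deriv F z)"
  proof (rule double_pole_circle_mean[OF _ _ z])
    show "F analytic_on cball 0 1" "g analytic_on cball 0 1"
      unfolding F_def g_def B_def C_def
      by (intro analytic_intros blaschke_analytic; use \<alpha> nB(2)[OF z] in \<open>simp add: B_def\<close>)+
    show "F z + g (1 / z) = 0"
      using nB(2)[OF z] by (simp add: F_def g_def C[OF z])
    show "deriv g (1 / z) = deriv F z * z\<^sup>2"
      using DERIV_imp_deriv[OF F_deriv] DERIV_imp_deriv[OF g_deriv] by simp
  qed
  hence "has_bochner_integral circle_measure
      (\<lambda>\<zeta>. \<zeta> * (F \<zeta> + g (1 / \<zeta>)) / (\<zeta> - z)\<^sup>2) (of_real (poisson_sum I m \<alpha> z))"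
    using DERIV_imp_deriv[OF F_deriv] by simp
  hence "has_bochner_integral circle_measure
      (\<lambda>\<zeta>. Re (\<zeta> * (F \<zeta> + g (1 / \<zeta>)) / (\<zeta> - z)\<^sup>2)) (Re (of_real (poisson_sum I m \<alpha> z)))"
    by (rule has_bochner_integral_Re)
  moreover have "\<zeta> * (F \<zeta> + g (1 / \<zeta>)) / (\<zeta> - z)\<^sup>2
      = of_real ((norm (B \<zeta> - B z))\<^sup>2 / (norm (\<zeta> - z))\<^sup>2)" if \<zeta>: "norm \<zeta> = 1" for \<zeta>
  proof (cases "\<zeta> = z")
    case False
    have \<zeta>0: "\<zeta> \<noteq> 0" using \<zeta> by auto
    have key: "complex_of_real ((norm (u - v))\<^sup>2) = - (u - v)\<^sup>2 / (u * v)"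
      if "norm u = 1" "norm v = 1" for u v :: complex
    proof -
      have "u \<noteq> 0" "v \<noteq> 0" using that by auto
      thus ?thesis
        unfolding complex_norm_square using that
        by (simp add: cnj_eq_inverse_circle field_simps power2_eq_square)
    qed
    have "F \<zeta> + g (1 / \<zeta>) = z * (B \<zeta> - B z)\<^sup>2 / (B \<zeta> * B z)"
      unfolding F_def g_def C[OF \<zeta>] using nB(2)[OF \<zeta>] nB(2)[OF z]
      by (simp add: field_simps power2_eq_square)
    have "\<zeta> * (F \<zeta> + g (1 / \<zeta>)) / (\<zeta> - z)\<^sup>2
        = (- (B \<zeta> - B z)\<^sup>2 / (B \<zeta> * B z)) / (- (\<zeta> - z)\<^sup>2 / (\<zeta> * z))"
      unfolding \<open>F \<zeta> + g (1 / \<zeta>) = _\<close> using \<zeta>0 z0 by simp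
    thus ?thesis
      by (simp only: of_real_divide key[OF nB(1)[OF \<zeta>] nB(1)[OF z]] key[OF \<zeta> z])
  qed auto
  ultimately show ?thesis
    by (subst (asm) has_bochner_integral_cong[of circle_measure circle_measure, OF refl _ refl,
          where g = "\<lambda>\<zeta>. (norm (B \<zeta> - B z))\<^sup>2 / (norm (\<zeta> - z))\<^sup>2"]) auto
qed

section \<open>The Poisson sum and its mean\<close>

lemma poisson_kernel_mean:
  assumes "norm a < 1"
  shows "has_bochner_integral circle_measure (\<lambda>\<zeta>. (1 - (norm a)\<^sup>2) / (norm (\<zeta> - a))\<^sup>2) 1"
proof -
  define \<phi> where "\<phi> = (\<lambda>w. 1 / (1 - a * w))"
  define \<psi> where "\<psi> = (\<lambda>\<zeta>. cnj a * \<zeta> / (1 - cnj a * \<zeta>))"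
  have "1 - a * w \<noteq> 0" "1 - cnj a * w \<noteq> 0" if "norm w \<le> 1" for w
    using one_minus_cnj_mult_neq_0[of "cnj a" w] one_minus_cnj_mult_neq_0[of a w] assms that by auto
  hence an: "\<phi> analytic_on cball 0 1" "\<psi> analytic_on cball 0 1"
    unfolding \<phi>_def \<psi>_def by (auto intro!: analytic_intros)
  have 1: "has_bochner_integral circle_measure (\<lambda>\<zeta>. \<phi> (1 / \<zeta>)) (\<phi> 0)"
    using an(1) by (intro circle_mean_holomorphic_inverse holomorphic_on_imp_continuous_on
          analytic_imp_holomorphic) (auto elim: analytic_on_subset)
  have 2: "has_bochner_integral circle_measure \<psi> (\<psi> 0)"
    using an(2) by (intro circle_mean_holomorphic holomorphic_on_imp_continuous_on
          analytic_imp_holomorphic) (auto elim: analytic_on_subset)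
  have "\<phi> (1 / \<zeta>) + \<psi> \<zeta> = of_real ((1 - (norm a)\<^sup>2) / (norm (\<zeta> - a))\<^sup>2)" if "norm \<zeta> = 1" for \<zeta>
  proof -
    have "\<zeta> \<noteq> 0" using that by auto
    hence "\<phi> (1 / \<zeta>) = \<zeta> / (\<zeta> - a)"
      by (auto simp: \<phi>_def divide_simps)
    thus ?thesis
      using circle_poisson_kernel_eq[OF assms that] by (simp add: \<psi>_def)
  qed
  hence "has_bochner_integral circle_measure
      (\<lambda>\<zeta>. complex_of_real ((1 - (norm a)\<^sup>2) / (norm (\<zeta> - a))\<^sup>2)) (\<phi> 0 + \<psi> 0)"
    using has_bochner_integral_add[OF 1 2]
    by (subst has_bochner_integral_cong[of circle_measure circle_measure, OF refl _ refl,
          where g = "\<lambda>\<zeta>. \<phi> (1 / \<zeta>) + \<psi> \<zeta>"]) auto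
  from has_bochner_integral_Re[OF this] show ?thesis
    by (simp add: \<phi>_def \<psi>_def)
qed

lemma poisson_sum_mean:
  assumes "\<And>i. i \<in> I \<Longrightarrow> norm (\<alpha> i) < 1"
  shows "has_bochner_integral circle_measure (poisson_sum I m \<alpha>) (real (\<Sum>i\<in>I. m i))"
proof -
  have "has_bochner_integral circle_measure (\<lambda>\<zeta>. \<Sum>i\<in>I. real (m i) * ((1 - (norm (\<alpha> i))\<^sup>2) / (norm (\<zeta> - \<alpha> i))\<^sup>2))
      (\<Sum>i\<in>I. real (m i) * 1)"
    by (intro has_bochner_integral_sum has_bochner_integral_mult_right poisson_kernel_mean assms)
  thus ?thesis by (simp add: poisson_sum_def[abs_def])
qed

lemma poisson_sum_nonneg:
  assumes "\<And>i. i \<in> I \<Longrightarrow> norm (\<alpha> i) < 1"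
  shows "0 \<le> poisson_sum I m \<alpha> \<zeta>"
  unfolding poisson_sum_def
  by (intro sum_nonneg mult_nonneg_nonneg divide_nonneg_nonneg)
    (use assms in \<open>auto simp: abs_square_le_1 less_imp_le\<close>)

lemma poisson_sum_le:
  assumes "\<And>i. i \<in> I \<Longrightarrow> norm (\<alpha> i) < 1" "norm \<zeta> = 1"
  shows "poisson_sum I m \<alpha> \<zeta> \<le> (\<Sum>i\<in>I. real (m i) * ((1 + norm (\<alpha> i)) / (1 - norm (\<alpha> i))))"
  unfolding poisson_sum_def
proof (intro sum_mono mult_left_mono)
  fix i assume i: "i \<in> I"
  define r where "r = norm (\<alpha> i)"
  have r: "0 \<le> r" "r < 1" using assms i by (auto simp: r_def)
  have "1 - r \<le> norm (\<zeta> - \<alpha> i)"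
    using norm_triangle_ineq2[of \<zeta> "\<alpha> i"] assms(2) by (simp add: r_def)
  hence "(1 - r)\<^sup>2 \<le> (norm (\<zeta> - \<alpha> i))\<^sup>2"
    using r by (intro power_mono) auto
  moreover have "0 \<le> 1 - r\<^sup>2" using r by (simp add: abs_square_le_1)
  ultimately have "(1 - r\<^sup>2) / (norm (\<zeta> - \<alpha> i))\<^sup>2 \<le> (1 - r\<^sup>2) / (1 - r)\<^sup>2"
    using r \<open>1 - r \<le> norm (\<zeta> - \<alpha> i)\<close>
    by (intro divide_left_mono mult_pos_pos zero_less_power) linarith+
  also have "(1 - r\<^sup>2) / (1 - r)\<^sup>2 = ((1 + r) * (1 - r)) / ((1 - r) * (1 - r))"
    by (simp add: power2_eq_square algebra_simps)
  also have "\<dots> = (1 + r) / (1 - r)"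
    using r by simp
  finally show "(1 - (norm (\<alpha> i))\<^sup>2) / (norm (\<zeta> - \<alpha> i))\<^sup>2 \<le> (1 + norm (\<alpha> i)) / (1 - norm (\<alpha> i))"
    by (simp add: r_def)
qed auto

lemma poisson_sum_continuous:
  assumes "\<And>i. i \<in> I \<Longrightarrow> norm (\<alpha> i) < 1"
  shows "continuous_on (sphere 0 1) (poisson_sum I m \<alpha>)"
  unfolding poisson_sum_def[abs_def]
  by (intro continuous_intros) (use assms in force)

section \<open>Bounding the derivative by a weighted integral of the function\<close>

text \<open>
  With \<open>u = b w / b x\<close> the factor multiplying \<open>h\<close> is \<open>2 * u - u\<^sup>2 = 1 - (1 - u)\<^sup>2\<close>, which at \<open>w = x\<close> has
  value \<open>1\<close> and derivative \<open>0\<close>. So the poles of \<open>h\<close> that \<open>b\<close> cancels can be removed without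
  changing the derivative at \<open>x\<close>.
\<close>

lemma stationary_factor_deriv:
  fixes h b :: "complex \<Rightarrow> complex"
  assumes "(h has_field_derivative h') (at x)" "(b has_field_derivative b') (at x)" "b x \<noteq> 0"
  shows "((\<lambda>w. h w * b w * (2 / b x - b w / (b x)\<^sup>2)) has_field_derivative h') (at x)"
proof -
  have "((\<lambda>w. h w * b w * (d - b w * c)) has_field_derivative
      ((h' * b x + b' * h x) * (d - b x * c) + (- (b' * c)) * (h x * b x))) (at x)" for c d
    by (rule derivative_eq_intros assms refl | simp)+
  from this[of "2 / b x" "1 / (b x)\<^sup>2"]
  have "((\<lambda>w. h w * b w * (2 / b x - b w / (b x)\<^sup>2)) has_field_derivative
      ((h' * b x + b' * h x) * (2 / b x - b x / (b x)\<^sup>2) - b' / (b x)\<^sup>2 * (h x * b x))) (at x)"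
    by simp
  moreover have "(h' * \<beta> + b' * h0) * (2 / \<beta> - \<beta> / \<beta>\<^sup>2) - b' / \<beta>\<^sup>2 * (h0 * \<beta>) = h'"
    if "\<beta> \<noteq> 0" for \<beta> h0 :: complex
  proof -
    have "2 / \<beta> - \<beta> / \<beta>\<^sup>2 = 1 / \<beta>" using that by (simp add: power2_eq_square field_simps)
    thus ?thesis using that by (simp add: power2_eq_square add_divide_distrib)
  qed
  ultimately show ?thesis using assms(3) by simp
qed

text \<open>
  This is the integral representation of \<open>f'\<close> and the estimate of its kernel. The functions \<open>g1\<close> and
  \<open>g2\<close> are the analytic continuations of \<open>f B\<^sub>1\<close> into the disc and, in the coordinate
  \<open>w = 1 / \<zeta>\<close>, of \<open>f / B\<^sub>2\<close> to the outside.
\<close>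

lemma norm_deriv_le_kernel_integral:
  fixes m1 :: "'i \<Rightarrow> nat" and m2 :: "'j \<Rightarrow> nat"
  assumes \<alpha>1: "\<And>i. i \<in> I \<Longrightarrow> norm (\<alpha>1 i) < 1" and \<alpha>2: "\<And>j. j \<in> J \<Longrightarrow> norm (\<alpha>2 j) < 1"
    and f: "f analytic_on sphere 0 1"
    and g1: "g1 analytic_on cball 0 1" and g2: "g2 analytic_on cball 0 1"
    and g1_eq: "\<And>\<zeta>. norm \<zeta> = 1 \<Longrightarrow> eventually (\<lambda>\<zeta>. g1 \<zeta> = f \<zeta> * blaschke I m1 \<alpha>1 \<zeta>) (nhds \<zeta>)"
    and g2_eq: "\<And>w. norm w = 1 \<Longrightarrow>
        eventually (\<lambda>w. g2 w = f (1 / w) * blaschke J m2 (\<lambda>j. cnj (\<alpha>2 j)) w) (nhds w)"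
    and z: "norm z = 1"
  defines "B1 \<equiv> blaschke I m1 \<alpha>1" and "B2 \<equiv> blaschke J m2 \<alpha>2"
  shows "ennreal (norm (deriv f z)) \<le>
    (\<integral>\<^sup>+\<zeta>. ennreal (norm (f \<zeta>) * ((norm (B1 \<zeta> - B1 z))\<^sup>2 / (norm (\<zeta> - z))\<^sup>2
        + (norm (B2 \<zeta> - B2 z))\<^sup>2 / (norm (\<zeta> - z))\<^sup>2)) \<partial>circle_measure)"
proof -
  define C2 where "C2 = blaschke J m2 (\<lambda>j. cnj (\<alpha>2 j))"
  have z0: "z \<noteq> 0" using z by auto
  have n1: "norm (B1 \<zeta>) = 1" if "norm \<zeta> = 1" for \<zeta>
    unfolding B1_def by (rule blaschke_norm) (use \<alpha>1 that in auto)
  have n2: "norm (B2 \<zeta>) = 1" if "norm \<zeta> = 1" for \<zeta>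
    unfolding B2_def by (rule blaschke_norm) (use \<alpha>2 that in auto)
  have C2: "C2 (1 / \<zeta>) = 1 / B2 \<zeta>" if "norm \<zeta> = 1" for \<zeta>
    unfolding C2_def B2_def by (rule blaschke_inverse) (use \<alpha>2 that in auto)
  have an: "B1 analytic_on cball 0 1" "C2 analytic_on cball 0 1"
    unfolding B1_def C2_def by (rule blaschke_analytic; use \<alpha>1 \<alpha>2 in simp)+
  have nz: "B1 z \<noteq> 0" "C2 (1 / z) \<noteq> 0" using n1[OF z] n2[OF z] by (auto simp: C2[OF z])
  \<comment> \<open>On the circle \<open>F\<close> is \<open>f (2 u - u\<^sup>2)\<close> with \<open>u = B\<^sub>1(\<zeta>) / B\<^sub>1(z)\<close>, and \<open>g (1 / \<zeta>)\<close> is \<open>- f (2 t - t\<^sup>2)\<close> with \<open>t = B\<^sub>2(z) / B\<^sub>2(\<zeta>)\<close>.\<close>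
  define F where "F = (\<lambda>\<zeta>. g1 \<zeta> * (2 / B1 z - B1 \<zeta> / (B1 z)\<^sup>2))"
  define g where "g = (\<lambda>w. - (g2 w * (2 / C2 (1 / z) - C2 w / (C2 (1 / z))\<^sup>2)))"
  have an_deriv: "(\<phi> has_field_derivative deriv \<phi> x) (at x)" if "\<phi> analytic_on S" "x \<in> S" for \<phi> x S
    using that by (meson analytic_on_imp_differentiable_at DERIV_deriv_iff_field_differentiable)
  have f': "(f has_field_derivative deriv f z) (at z)"
    by (rule an_deriv[OF f]) (use z in auto)
  have F_deriv: "(F has_field_derivative deriv f z) (at z)"
  proof (subst DERIV_cong_ev[OF refl _ refl])
    show "\<forall>\<^sub>F \<zeta> in nhds z. F \<zeta> = f \<zeta> * B1 \<zeta> * (2 / B1 z - B1 \<zeta> / (B1 z)\<^sup>2)"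
      using g1_eq[OF z] by eventually_elim (simp add: F_def B1_def)
    show "((\<lambda>\<zeta>. f \<zeta> * B1 \<zeta> * (2 / B1 z - B1 \<zeta> / (B1 z)\<^sup>2)) has_field_derivative deriv f z) (at z)"
      by (rule stationary_factor_deriv[OF f' an_deriv[OF an(1)] nz(1)]) (use z in auto)
  qed
  have "((\<lambda>w. f (1 / w)) has_field_derivative (- (deriv f z * z\<^sup>2))) (at (1 / z))"
  proof -
    have "((\<lambda>w. 1 / w) has_field_derivative - (z\<^sup>2)) (at (1 / z))"
      using z0 by (auto intro!: derivative_eq_intros simp: power2_eq_square)
    from DERIV_chain2[of f _ "\<lambda>w. 1 / w", OF _ this] f' z0 show ?thesis by simp
  qed
  from stationary_factor_deriv[OF this an_deriv[OF an(2)] nz(2)]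
  have g_deriv': "((\<lambda>w. f (1 / w) * C2 w * (2 / C2 (1 / z) - C2 w / (C2 (1 / z))\<^sup>2))
      has_field_derivative (- (deriv f z * z\<^sup>2))) (at (1 / z))"
    using z by (simp add: norm_divide)
  have g_deriv: "(g has_field_derivative deriv f z * z\<^sup>2) (at (1 / z))"
  proof (subst DERIV_cong_ev[OF refl _ refl])
    have "norm (1 / z) = 1" using z by (simp add: norm_divide)
    from g2_eq[OF this]
    show "\<forall>\<^sub>F w in nhds (1 / z). g w = - (f (1 / w) * C2 w * (2 / C2 (1 / z) - C2 w / (C2 (1 / z))\<^sup>2))"
      by eventually_elim (simp add: g_def C2_def)
    show "((\<lambda>w. - (f (1 / w) * C2 w * (2 / C2 (1 / z) - C2 w / (C2 (1 / z))\<^sup>2)))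
      has_field_derivative deriv f z * z\<^sup>2) (at (1 / z))"
      using DERIV_minus[OF g_deriv'] by simp
  qed
  have Fg: "F \<zeta> + g (1 / \<zeta>) = f \<zeta> * ((1 - B2 z / B2 \<zeta>)\<^sup>2 - (1 - B1 \<zeta> / B1 z)\<^sup>2)" if \<zeta>: "norm \<zeta> = 1" for \<zeta>
  proof -
    have "norm (1 / \<zeta>) = 1" using \<zeta> by (simp add: norm_divide)
    hence e2: "g2 (1 / \<zeta>) = f \<zeta> * (1 / B2 \<zeta>)"
      using eventually_nhds_x_imp_x[OF g2_eq] C2[OF \<zeta>] by (simp add: C2_def)
    have e1: "g1 \<zeta> = f \<zeta> * B1 \<zeta>"
      using eventually_nhds_x_imp_x[OF g1_eq[OF \<zeta>]] by (simp add: B1_def)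
    have "B2 \<zeta> \<noteq> 0" "B2 z \<noteq> 0" using n2 \<zeta> z by fastforce+
    hence s: "(1 / B2 \<zeta>) * (2 / (1 / B2 z) - (1 / B2 \<zeta>) / (1 / B2 z)\<^sup>2)
        = 2 * (B2 z / B2 \<zeta>) - (B2 z / B2 \<zeta>)\<^sup>2"
      by (simp add: power2_eq_square right_diff_distrib)
    have r: "B1 \<zeta> * (2 / B1 z - B1 \<zeta> / (B1 z)\<^sup>2) = 2 * (B1 \<zeta> / B1 z) - (B1 \<zeta> / B1 z)\<^sup>2"
      by (simp add: power2_eq_square right_diff_distrib)
    have "F \<zeta> + g (1 / \<zeta>) = f \<zeta> * (2 * (B1 \<zeta> / B1 z) - (B1 \<zeta> / B1 z)\<^sup>2)
        - f \<zeta> * (2 * (B2 z / B2 \<zeta>) - (B2 z / B2 \<zeta>)\<^sup>2)"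
      unfolding F_def g_def e1 e2 C2[OF \<zeta>] C2[OF z] r[symmetric] s[symmetric]
      by (simp only: mult.assoc add_uminus_conv_diff)
    also have "\<dots> = f \<zeta> * ((1 - B2 z / B2 \<zeta>)\<^sup>2 - (1 - B1 \<zeta> / B1 z)\<^sup>2)"
    proof -
      have "c * (2 * x - x\<^sup>2) - c * (2 * y - y\<^sup>2) = c * ((1 - y)\<^sup>2 - (1 - x)\<^sup>2)" for c x y :: complex
        by (simp add: power2_eq_square algebra_simps)
      thus ?thesis .
    qed
    finally show ?thesis .
  qed
  have "has_bochner_integral circle_measure (\<lambda>\<zeta>. \<zeta> * (F \<zeta> + g (1 / \<zeta>)) / (\<zeta> - z)\<^sup>2) (deriv F z)"
  proof (rule double_pole_circle_mean[OF _ _ z])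
    show "F analytic_on cball 0 1" "g analytic_on cball 0 1"
      unfolding F_def g_def by (intro analytic_intros g1 g2 an; use nz in simp)+
    show "F z + g (1 / z) = 0"
      unfolding Fg[OF z] using n1[OF z] n2[OF z] by auto
    show "deriv g (1 / z) = deriv F z * z\<^sup>2"
      using DERIV_imp_deriv[OF F_deriv] DERIV_imp_deriv[OF g_deriv] by simp
  qed
  hence int: "has_bochner_integral circle_measure (\<lambda>\<zeta>. \<zeta> * (F \<zeta> + g (1 / \<zeta>)) / (\<zeta> - z)\<^sup>2) (deriv f z)"
    using DERIV_imp_deriv[OF F_deriv] by simp
  have "ennreal (norm (deriv f z))
      \<le> (\<integral>\<^sup>+\<zeta>. ennreal (norm (\<zeta> * (F \<zeta> + g (1 / \<zeta>)) / (\<zeta> - z)\<^sup>2)) \<partial>circle_measure)"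
    using integral_norm_bound_ennreal[OF integrable.intros[OF int]]
      has_bochner_integral_integral_eq[OF int] by simp
  also have "\<dots> \<le> (\<integral>\<^sup>+\<zeta>. ennreal (norm (f \<zeta>) * ((norm (B1 \<zeta> - B1 z))\<^sup>2 / (norm (\<zeta> - z))\<^sup>2
        + (norm (B2 \<zeta> - B2 z))\<^sup>2 / (norm (\<zeta> - z))\<^sup>2)) \<partial>circle_measure)"
  proof (rule nn_integral_mono, rule ennreal_leI)
    fix \<zeta> assume "\<zeta> \<in> space circle_measure"
    hence \<zeta>: "norm \<zeta> = 1" by simp
    have "B1 z \<noteq> 0" "B2 \<zeta> \<noteq> 0" using n1[OF z] n2[OF \<zeta>] by auto
    hence "1 - B1 \<zeta> / B1 z = - (B1 \<zeta> - B1 z) / B1 z" "1 - B2 z / B2 \<zeta> = (B2 \<zeta> - B2 z) / B2 \<zeta>"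
      by (simp_all add: diff_divide_distrib)
    hence k: "norm (1 - B1 \<zeta> / B1 z) = norm (B1 \<zeta> - B1 z)"
        "norm (1 - B2 z / B2 \<zeta>) = norm (B2 \<zeta> - B2 z)"
      using n1[OF z] n2[OF \<zeta>] by (simp_all only: norm_divide norm_minus_cancel div_by_1)
    have "norm (\<zeta> * (F \<zeta> + g (1 / \<zeta>)) / (\<zeta> - z)\<^sup>2)
        = norm (f \<zeta>) * (norm ((1 - B2 z / B2 \<zeta>)\<^sup>2 - (1 - B1 \<zeta> / B1 z)\<^sup>2) / (norm (\<zeta> - z))\<^sup>2)"
      unfolding Fg[OF \<zeta>] by (simp only: norm_mult norm_divide norm_power \<zeta> mult_1 times_divide_eq_right)
    also have "\<dots> \<le> norm (f \<zeta>) * (((norm (B2 \<zeta> - B2 z))\<^sup>2 + (norm (B1 \<zeta> - B1 z))\<^sup>2) / (norm (\<zeta> - z))\<^sup>2)"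
      by (intro mult_left_mono divide_right_mono order.trans[OF norm_triangle_ineq4])
        (simp_all only: norm_power k order.refl norm_ge_zero zero_le_power2)
    finally show "norm (\<zeta> * (F \<zeta> + g (1 / \<zeta>)) / (\<zeta> - z)\<^sup>2)
        \<le> norm (f \<zeta>) * ((norm (B1 \<zeta> - B1 z))\<^sup>2 / (norm (\<zeta> - z))\<^sup>2
            + (norm (B2 \<zeta> - B2 z))\<^sup>2 / (norm (\<zeta> - z))\<^sup>2)"
      by (simp only: add_divide_distrib add.commute)
  qed
  finally show ?thesis .
qed

text \<open>
  Integrate the preceding bound over \<open>z\<close> and exchange the integrals: the kernel is symmetric, so its
  integral over \<open>z\<close> is again given by \<open>blaschke_kernel_mean\<close>.
\<close>

lemma L1_deriv_le_poisson_integral: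
  fixes m1 :: "'i \<Rightarrow> nat" and m2 :: "'j \<Rightarrow> nat"
  assumes \<alpha>1: "\<And>i. i \<in> I \<Longrightarrow> norm (\<alpha>1 i) < 1" and \<alpha>2: "\<And>j. j \<in> J \<Longrightarrow> norm (\<alpha>2 j) < 1"
    and f: "f analytic_on sphere 0 1"
    and g1: "g1 analytic_on cball 0 1" and g2: "g2 analytic_on cball 0 1"
    and g1_eq: "\<And>\<zeta>. norm \<zeta> = 1 \<Longrightarrow> eventually (\<lambda>\<zeta>. g1 \<zeta> = f \<zeta> * blaschke I m1 \<alpha>1 \<zeta>) (nhds \<zeta>)"
    and g2_eq: "\<And>w. norm w = 1 \<Longrightarrow>
        eventually (\<lambda>w. g2 w = f (1 / w) * blaschke J m2 (\<lambda>j. cnj (\<alpha>2 j)) w) (nhds w)"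
  shows "(\<integral>z. norm (deriv f z) \<partial>circle_measure)
    \<le> (\<integral>\<zeta>. norm (f \<zeta>) * poisson_sum I m1 \<alpha>1 \<zeta> \<partial>circle_measure)
      + (\<integral>\<zeta>. norm (f \<zeta>) * poisson_sum J m2 \<alpha>2 \<zeta> \<partial>circle_measure)"
proof -
  define B1 where "B1 = blaschke I m1 \<alpha>1"
  define B2 where "B2 = blaschke J m2 \<alpha>2"
  define P1 where "P1 = poisson_sum I m1 \<alpha>1"
  define P2 where "P2 = poisson_sum J m2 \<alpha>2"
  interpret prob_space circle_measure by (rule prob_space_circle_measure)
  interpret pair_sigma_finite circle_measure circle_measure ..
  have P_nonneg: "0 \<le> P1 \<zeta>" "0 \<le> P2 \<zeta>" for \<zeta>
    unfolding P1_def P2_def by (rule poisson_sum_nonneg; use \<alpha>1 \<alpha>2 in simp)+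
  have f_cont: "continuous_on (sphere 0 1) f" and f'_cont: "continuous_on (sphere 0 1) (deriv f)"
    using f analytic_deriv[OF f]
    by (auto intro!: holomorphic_on_imp_continuous_on analytic_imp_holomorphic)
  have B_cont: "continuous_on (sphere 0 1) B1" "continuous_on (sphere 0 1) B2"
  proof -
    have "B1 analytic_on sphere 0 1" "B2 analytic_on sphere 0 1"
      unfolding B1_def B2_def
      by (rule analytic_on_subset[OF blaschke_analytic]; use \<alpha>1 \<alpha>2 in simp)+
    thus "continuous_on (sphere 0 1) B1" "continuous_on (sphere 0 1) B2"
      by (auto intro!: holomorphic_on_imp_continuous_on analytic_imp_holomorphic)
  qed
  have P_cont: "continuous_on (sphere 0 1) P1" "continuous_on (sphere 0 1) P2"
    unfolding P1_def P2_def by (rule poisson_sum_continuous; use \<alpha>1 \<alpha>2 in simp)+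
  define k where "k \<zeta> z = norm (f \<zeta>) * ((norm (B1 \<zeta> - B1 z))\<^sup>2 / (norm (\<zeta> - z))\<^sup>2
        + (norm (B2 \<zeta> - B2 z))\<^sup>2 / (norm (\<zeta> - z))\<^sup>2)" for \<zeta> z
  note [measurable] = continuous_circle_measurable[OF f_cont]
    continuous_circle_measurable[OF B_cont(1)] continuous_circle_measurable[OF B_cont(2)]
  have [measurable]: "(\<lambda>x. x) \<in> borel_measurable circle_measure"
    by (intro continuous_circle_measurable continuous_intros)
  have [measurable]: "fst \<in> borel_measurable (circle_measure \<Otimes>\<^sub>M circle_measure)"
    "snd \<in> borel_measurable (circle_measure \<Otimes>\<^sub>M circle_measure)"
    using measurable_compose[OF measurable_fst[of circle_measure circle_measure], of "\<lambda>x. x" borel]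
      measurable_compose[OF measurable_snd[of circle_measure circle_measure], of "\<lambda>x. x" borel] by auto
  have k_meas: "(\<lambda>(\<zeta>, z). ennreal (k \<zeta> z)) \<in> borel_measurable (circle_measure \<Otimes>\<^sub>M circle_measure)"
    unfolding k_def case_prod_beta by measurable
  have inner: "(\<integral>\<^sup>+z. ennreal (k \<zeta> z) \<partial>circle_measure) = ennreal (norm (f \<zeta>) * (P1 \<zeta> + P2 \<zeta>))"
    if \<zeta>: "norm \<zeta> = 1" for \<zeta>
  proof -
    have "has_bochner_integral circle_measure
        (\<lambda>z. norm (f \<zeta>) * ((norm (B1 z - B1 \<zeta>))\<^sup>2 / (norm (z - \<zeta>))\<^sup>2
          + (norm (B2 z - B2 \<zeta>))\<^sup>2 / (norm (z - \<zeta>))\<^sup>2)) (norm (f \<zeta>) * (P1 \<zeta> + P2 \<zeta>))"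
      unfolding B1_def B2_def P1_def P2_def
      by (intro has_bochner_integral_mult_right has_bochner_integral_add blaschke_kernel_mean \<zeta>)
        (use \<alpha>1 \<alpha>2 in auto)
    hence "has_bochner_integral circle_measure (k \<zeta>) (norm (f \<zeta>) * (P1 \<zeta> + P2 \<zeta>))"
      by (simp add: k_def[abs_def] norm_minus_commute)
    moreover have "0 \<le> k \<zeta> z" for z by (simp add: k_def)
    ultimately show ?thesis
      by (simp add: has_bochner_integral_iff nn_integral_eq_integral)
  qed
  have fP_int: "integrable circle_measure (\<lambda>\<zeta>. norm (f \<zeta>) * P1 \<zeta>)"
    "integrable circle_measure (\<lambda>\<zeta>. norm (f \<zeta>) * P2 \<zeta>)"
    by (intro continuous_circle_integrable continuous_intros f_cont P_cont)+
  have "ennreal (\<integral>z. norm (deriv f z) \<partial>circle_measure)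
      = (\<integral>\<^sup>+z. ennreal (norm (deriv f z)) \<partial>circle_measure)"
    by (intro nn_integral_eq_integral[symmetric] continuous_circle_integrable continuous_intros f'_cont) auto
  also have "\<dots> \<le> (\<integral>\<^sup>+z. \<integral>\<^sup>+\<zeta>. ennreal (k \<zeta> z) \<partial>circle_measure \<partial>circle_measure)"
  proof (rule nn_integral_mono)
    fix z assume "z \<in> space circle_measure"
    thus "ennreal (norm (deriv f z)) \<le> (\<integral>\<^sup>+\<zeta>. ennreal (k \<zeta> z) \<partial>circle_measure)"
      unfolding k_def B1_def B2_def
      by (intro norm_deriv_le_kernel_integral[OF _ _ f g1 g2 g1_eq g2_eq]) (use \<alpha>1 \<alpha>2 in auto)
  qed
  also have "\<dots> = (\<integral>\<^sup>+\<zeta>. \<integral>\<^sup>+z. ennreal (k \<zeta> z) \<partial>circle_measure \<partial>circle_measure)"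
    by (rule Fubini'[OF k_meas])
  also have "\<dots> = (\<integral>\<^sup>+\<zeta>. ennreal (norm (f \<zeta>) * P1 \<zeta> + norm (f \<zeta>) * P2 \<zeta>) \<partial>circle_measure)"
    by (intro nn_integral_cong) (simp add: inner distrib_left)
  also have "\<dots> = ennreal (\<integral>\<zeta>. norm (f \<zeta>) * P1 \<zeta> + norm (f \<zeta>) * P2 \<zeta> \<partial>circle_measure)"
    using P_nonneg by (intro nn_integral_eq_integral Bochner_Integration.integrable_add fP_int) auto
  also have "(\<integral>\<zeta>. norm (f \<zeta>) * P1 \<zeta> + norm (f \<zeta>) * P2 \<zeta> \<partial>circle_measure)
      = (\<integral>\<zeta>. norm (f \<zeta>) * P1 \<zeta> \<partial>circle_measure) + (\<integral>\<zeta>. norm (f \<zeta>) * P2 \<zeta> \<partial>circle_measure)"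
    by (intro Bochner_Integration.integral_add fP_int)
  finally show ?thesis
    using P_nonneg unfolding P1_def[symmetric] P2_def[symmetric]
    by (subst (asm) ennreal_le_iff) (auto intro!: add_nonneg_nonneg integral_nonneg_AE)
qed

section \<open>Interpolating between the mean and the maximum of the weight\<close>

lemma young_inequality_powr:
  fixes x c q :: real
  assumes "0 \<le> x" "0 < c" "1 \<le> q"
  shows "x * c powr (q - 1) \<le> x powr q / q + (1 - 1 / q) * c powr q"
proof (cases "x = 0")
  case False
  have "(x powr q) powr (1 / q) * (c powr q) powr (1 - 1 / q) \<le> 1 / q * x powr q + (1 - 1 / q) * c powr q"
    by (rule Youngs_inequality_0) (use assms False in auto)
  also have "(x powr q) powr (1 / q) = x" using assms False by (simp add: powr_powr)
  also have "(c powr q) powr (1 - 1 / q) = c powr (q - 1)"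
    using assms by (simp add: powr_powr right_diff_distrib)
  finally show ?thesis by simp
qed (use assms in auto)

text \<open>
  Hoelder's inequality with respect to the measure \<open>w dm\<close> of total mass \<open>N\<close>, followed by \<open>w \<le> D\<close>.
  The proof integrates Young's inequality \<open>young_inequality_powr\<close> against \<open>w\<close>, with \<open>c\<close> the \<open>w\<close>-average of \<open>|f|\<close>,
  the choice for which it is sharp when \<open>|f|\<close> is constant.
\<close>

lemma weighted_integral_le_Lp_norm:
  fixes p :: ereal and w :: "complex \<Rightarrow> real"
  assumes f: "continuous_on (sphere 0 1) f" and w: "continuous_on (sphere 0 1) w"
    and w_bounds: "\<And>\<zeta>. norm \<zeta> = 1 \<Longrightarrow> 0 \<le> w \<zeta>" "\<And>\<zeta>. norm \<zeta> = 1 \<Longrightarrow> w \<zeta> \<le> D"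
    and w_mean: "(\<integral>\<zeta>. w \<zeta> \<partial>circle_measure) = N" and N: "0 < N" and p: "1 \<le> p"
  shows "(\<integral>\<zeta>. norm (f \<zeta>) * w \<zeta> \<partial>circle_measure)
    \<le> N powr (1 - real_of_ereal (1 / p)) * D powr real_of_ereal (1 / p) * Lp_norm p f"
proof -
  interpret prob_space circle_measure by (rule prob_space_circle_measure)
  have w_int: "integrable circle_measure w" by (rule continuous_circle_integrable[OF w])
  have fw_int: "integrable circle_measure (\<lambda>\<zeta>. norm (f \<zeta>) * w \<zeta>)"
    by (intro continuous_circle_integrable continuous_intros f w)
  have D: "0 < D"
  proof -
    have "N \<le> (\<integral>\<zeta>. D \<partial>circle_measure)"
      unfolding w_mean[symmetric] by (intro integral_mono w_int) (auto simp: w_bounds)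
    thus ?thesis using N prob_space by simp
  qed
  define A where "A = (\<integral>\<zeta>. norm (f \<zeta>) * w \<zeta> \<partial>circle_measure)"
  have A: "0 \<le> A" unfolding A_def by (intro integral_nonneg_AE AE_I2) (auto simp: w_bounds)
  show ?thesis
  proof (cases "p = \<infinity>")
    case True
    have norm_meas: "(\<lambda>\<zeta>. ereal (norm (f \<zeta>))) \<in> borel_measurable circle_measure"
      using continuous_circle_measurable[OF f] by measurable
    define E where "E = esssup circle_measure (\<lambda>\<zeta>. ereal (norm (f \<zeta>)))"
    have "bounded (f ` sphere 0 1)"
      by (intro compact_imp_bounded compact_continuous_image f compact_sphere)
    then obtain C where C: "\<forall>x\<in>sphere 0 1. norm (f x) \<le> C" by (auto simp: bounded_iff)
    have "E \<le> ereal C"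
      unfolding E_def by (intro esssup_I norm_meas AE_I2) (use C in auto)
    hence E_top: "E \<noteq> \<infinity>" by auto
    have "AE \<zeta> in circle_measure. ereal (norm (f \<zeta>)) \<le> E"
      unfolding E_def by (rule esssup_AE)
    moreover have "E \<noteq> -\<infinity>"
    proof
      assume "E = -\<infinity>"
      with calculation have "AE \<zeta> in circle_measure. False" by simp
      thus False by simp
    qed
    ultimately have ae: "AE \<zeta> in circle_measure. norm (f \<zeta>) \<le> real_of_ereal E"
      using E_top by (cases E) auto
    have "A \<le> (\<integral>\<zeta>. real_of_ereal E * w \<zeta> \<partial>circle_measure)"
      unfolding A_def
    proof (rule integral_mono_AE[OF fw_int])
      show "integrable circle_measure (\<lambda>\<zeta>. real_of_ereal E * w \<zeta>)" using w_int by simp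
      show "AE \<zeta> in circle_measure. norm (f \<zeta>) * w \<zeta> \<le> real_of_ereal E * w \<zeta>"
        using ae AE_space by eventually_elim (auto intro: mult_right_mono w_bounds)
    qed
    also have "\<dots> = N * real_of_ereal E" by (simp add: w_mean)
    finally show ?thesis
      using True N D by (simp add: A_def Lp_norm_def E_def)
  next
    case False
    then obtain q where q: "p = ereal q" "1 \<le> q" using p by (cases p) (auto simp: one_ereal_def)
    have inv: "real_of_ereal (1 / p) = 1 / q"
      using q by (simp add: one_ereal_def)
    define S where "S = (\<integral>\<zeta>. norm (f \<zeta>) powr q \<partial>circle_measure)"
    have norm: "Lp_norm p f = S powr (1 / q)" using q by (simp add: Lp_norm_def S_def)
    have fq_cont: "continuous_on (sphere 0 1) (\<lambda>\<zeta>. norm (f \<zeta>) powr q)"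
      by (rule continuous_on_powr') (use f q in \<open>auto intro!: continuous_intros\<close>)
    have S_int: "integrable circle_measure (\<lambda>\<zeta>. norm (f \<zeta>) powr q)"
      by (rule continuous_circle_integrable[OF fq_cont])
    have fqw_int: "integrable circle_measure (\<lambda>\<zeta>. norm (f \<zeta>) powr q * w \<zeta>)"
      by (intro continuous_circle_integrable continuous_intros fq_cont w)
    have S0: "0 \<le> S" unfolding S_def by (intro integral_nonneg_AE AE_I2) auto
    show ?thesis
    proof (cases "A = 0")
      case True
      thus ?thesis using N D by (simp add: A_def[symmetric] norm)
    next
      case False
      define c where "c = A / N"
      have c: "0 < c" using False A N by (simp add: c_def)
      have "c powr (q - 1) * A = (\<integral>\<zeta>. c powr (q - 1) * (norm (f \<zeta>) * w \<zeta>) \<partial>circle_measure)"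
        by (simp add: A_def)
      also have "\<dots> \<le> (\<integral>\<zeta>. (1 / q) * (norm (f \<zeta>) powr q * w \<zeta>) + ((1 - 1 / q) * c powr q) * w \<zeta> \<partial>circle_measure)"
      proof (rule integral_mono)
        fix \<zeta> assume "\<zeta> \<in> space circle_measure"
        hence "norm \<zeta> = 1" by simp
        hence "norm (f \<zeta>) * c powr (q - 1) * w \<zeta> \<le> (norm (f \<zeta>) powr q / q + (1 - 1 / q) * c powr q) * w \<zeta>"
          by (intro mult_right_mono young_inequality_powr w_bounds c q) auto
        thus "c powr (q - 1) * (norm (f \<zeta>) * w \<zeta>)
          \<le> (1 / q) * (norm (f \<zeta>) powr q * w \<zeta>) + ((1 - 1 / q) * c powr q) * w \<zeta>"
          by (simp add: distrib_right distrib_left mult_ac)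
      qed (use fw_int fqw_int w_int in auto)
      also have "\<dots> = (1 / q) * (\<integral>\<zeta>. norm (f \<zeta>) powr q * w \<zeta> \<partial>circle_measure) + ((1 - 1 / q) * c powr q) * N"
        using fqw_int w_int by (simp add: w_mean)
      also have "\<dots> \<le> (1 / q) * (S * D) + ((1 - 1 / q) * c powr q) * N"
      proof -
        have "(\<integral>\<zeta>. norm (f \<zeta>) powr q * w \<zeta> \<partial>circle_measure)
            \<le> (\<integral>\<zeta>. norm (f \<zeta>) powr q * D \<partial>circle_measure)"
          by (intro integral_mono fqw_int mult_left_mono) (use S_int in \<open>auto simp: w_bounds\<close>)
        also have "\<dots> = S * D" by (simp add: S_def)
        finally show ?thesis using q by (intro add_right_mono mult_left_mono) auto
      qed
      finally have 1: "c powr (q - 1) * A \<le> (1 / q) * (S * D) + ((1 - 1 / q) * c powr q) * N" .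
      have "c powr q = c powr (q - 1) * c"
        using c powr_add[of c "q - 1" 1] by simp
      hence "c powr (q - 1) * A = c powr q * N"
        using N by (simp add: c_def)
      with 1 have "(1 / q) * (c powr q * N) \<le> (1 / q) * (S * D)"
        by (simp add: algebra_simps)
      hence "c powr q * N \<le> S * D" using q by (simp add: divide_le_cancel)
      hence "c powr q \<le> S * D / N" using N by (simp add: pos_le_divide_eq)
      hence "(c powr q) powr (1 / q) \<le> (S * D / N) powr (1 / q)"
        using q by (intro powr_mono2) auto
      also have "(c powr q) powr (1 / q) = c" using c q by (simp add: powr_powr)
      also have "(S * D / N) powr (1 / q) = S powr (1 / q) * D powr (1 / q) / N powr (1 / q)"
        using S0 D N by (simp add: powr_mult powr_divide)
      finally have "A \<le> N * (S powr (1 / q) * D powr (1 / q) / N powr (1 / q))"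
        using N by (simp add: c_def pos_divide_le_eq mult.commute)
      also have "\<dots> = N powr (1 - 1 / q) * D powr (1 / q) * S powr (1 / q)"
        using N by (simp add: powr_diff)
      finally show ?thesis by (simp add: A_def norm inv)
    qed
  qed
qed

lemma poisson_integral_le_Lp_norm:
  fixes p :: ereal and m :: "'i \<Rightarrow> nat"
  assumes \<alpha>: "\<And>i. i \<in> I \<Longrightarrow> norm (\<alpha> i) < 1" and I: "finite I"
    and f: "continuous_on (sphere 0 1) f" and p: "1 \<le> p"
  defines "N \<equiv> \<Sum>i\<in>I. m i" and "D \<equiv> \<Sum>i\<in>I. real (m i) * ((1 + norm (\<alpha> i)) / (1 - norm (\<alpha> i)))"
  shows "(\<integral>\<zeta>. norm (f \<zeta>) * poisson_sum I m \<alpha> \<zeta> \<partial>circle_measure)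
    \<le> (if N = 0 then 0 else real N powr (1 - real_of_ereal (1 / p)) * D powr real_of_ereal (1 / p))
        * Lp_norm p f"
proof (cases "N = 0")
  case True
  hence "poisson_sum I m \<alpha> \<zeta> = 0" for \<zeta>
    using I by (simp add: N_def poisson_sum_def)
  thus ?thesis using True by simp
next
  case False
  have "(\<integral>\<zeta>. norm (f \<zeta>) * poisson_sum I m \<alpha> \<zeta> \<partial>circle_measure)
    \<le> real N powr (1 - real_of_ereal (1 / p)) * D powr real_of_ereal (1 / p) * Lp_norm p f"
  proof (rule weighted_integral_le_Lp_norm[OF f _ _ _ _ _ p])
    show "(\<integral>\<zeta>. poisson_sum I m \<alpha> \<zeta> \<partial>circle_measure) = real N"
      unfolding N_def by (intro has_bochner_integral_integral_eq poisson_sum_mean \<alpha>)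
    show "poisson_sum I m \<alpha> \<zeta> \<le> D" if "norm \<zeta> = 1" for \<zeta>
      unfolding D_def by (rule poisson_sum_le[OF \<alpha> that])
  qed (use False \<alpha> in \<open>auto intro!: poisson_sum_continuous poisson_sum_nonneg\<close>)
  thus ?thesis using False by simp
qed

section \<open>Poles of rational functions\<close>

lemma quot_of_fract_no_common_root:
  fixes f :: "complex poly fract"
  shows "poly (fst (quot_of_fract f)) z \<noteq> 0 \<or> poly (snd (quot_of_fract f)) z \<noteq> 0"
  by (rule coprime_poly_0[OF coprime_quot_of_fract])

lemma rational_functions_denom_nonzero_circle:
  assumes "f \<in> rational_functions n" "norm \<xi> = 1"
  shows "poly (snd (quot_of_fract f)) \<xi> \<noteq> 0"
proof
  assume 0: "poly (snd (quot_of_fract f)) \<xi> = 0"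
  obtain P Q where PQ: "f = Fract P Q" "poly Q \<xi> \<noteq> 0"
    using assms by (auto simp: rational_functions_def)
  hence "Q \<noteq> 0" by auto
  have "Fract (fst (quot_of_fract f)) (snd (quot_of_fract f)) = Fract P Q"
    using PQ by simp
  hence "fst (quot_of_fract f) * Q = P * snd (quot_of_fract f)"
    using \<open>Q \<noteq> 0\<close> by (subst (asm) eq_fract) auto
  hence "poly (fst (quot_of_fract f)) \<xi> * poly Q \<xi> = poly P \<xi> * poly (snd (quot_of_fract f)) \<xi>"
    by (metis poly_mult)
  thus False using 0 PQ quot_of_fract_no_common_root[of f \<xi>] by simp
qed

lemma poles_eq_roots: "poles f = {z. poly (snd (quot_of_fract f)) z = 0}"
proof -
  define P Q where "P = fst (quot_of_fract f)" and "Q = snd (quot_of_fract f)"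
  have Q0: "Q \<noteq> 0" by (simp add: Q_def)
  have ev: "rat_eval f = (\<lambda>z. poly P z / poly Q z)"
    by (simp add: rat_eval_def P_def Q_def fun_eq_iff)
  have "is_pole (rat_eval f) z \<longleftrightarrow> poly Q z = 0" for z
  proof (cases "poly Q z = 0")
    case True
    have "open (- ({w. poly Q w = 0} - {z}))"
      by (intro open_Compl finite_imp_closed finite_Diff poly_roots_finite Q0)
    hence "eventually (\<lambda>w. poly Q w \<noteq> 0) (at z)"
      unfolding eventually_at_topological by (intro exI[of _ "- ({w. poly Q w = 0} - {z})"]) auto
    hence "filterlim (poly Q) (at 0) (at z)"
      using True isCont_def[of z "poly Q"] by (auto simp: filterlim_at poly_isCont)
    moreover have "poly P z \<noteq> 0"
      using True quot_of_fract_no_common_root[of f z] by (simp add: P_def Q_def)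
    ultimately show ?thesis
      using True unfolding ev by (auto intro!: is_pole_divide poly_isCont)
  next
    case False
    have "open {w. poly Q w \<noteq> 0}"
      by (intro open_Collect_neq continuous_intros)
    moreover have "(\<lambda>z. poly P z / poly Q z) holomorphic_on {w. poly Q w \<noteq> 0}"
      by (intro holomorphic_intros) auto
    ultimately show ?thesis
      using False unfolding ev by (auto dest: not_is_pole_holomorphic[of _ z])
  qed
  thus ?thesis by (simp add: poles_def Q_def)
qed

lemma pole_mult_eq_order:
  assumes "z \<in> poles f"
  shows "pole_mult f z = order z (snd (quot_of_fract f))"
proof -
  define P Q where "P = fst (quot_of_fract f)" and "Q = snd (quot_of_fract f)"
  have Q0: "Q \<noteq> 0" by (simp add: Q_def)
  have Qz: "poly Q z = 0" using assms by (simp add: poles_eq_roots Q_def)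
  obtain q where q: "Q = [:- z, 1:] ^ order z Q * q" "\<not> [:- z, 1:] dvd q"
    using order_decomp[OF Q0] by blast
  have qz: "poly q z \<noteq> 0" using q(2) by (simp add: poly_eq_0_iff_dvd)
  have Pz: "poly P z \<noteq> 0"
    using Qz quot_of_fract_no_common_root[of f z] by (simp add: P_def Q_def)
  have "zorder (rat_eval f) z = - int (order z Q)"
  proof (rule zorder_eqI)
    show "open {w. poly q w \<noteq> 0}"
      by (intro open_Collect_neq continuous_intros)
    show "(\<lambda>w. poly P w / poly q w) holomorphic_on {w. poly q w \<noteq> 0}"
      by (intro holomorphic_intros) auto
    fix w assume "w \<in> {w. poly q w \<noteq> 0}" "w \<noteq> z"
    have "poly Q w = (w - z) ^ order z Q * poly q w"
      using arg_cong[OF q(1), of "\<lambda>p. poly p w"] by (simp add: poly_power)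
    thus "rat_eval f w = poly P w / poly q w * (w - z) powi (- int (order z Q))"
      unfolding rat_eval_def P_def[symmetric] Q_def[symmetric]
      by (simp add: power_int_minus field_simps)
  qed (use qz Pz in auto)
  thus ?thesis using assms by (simp add: pole_mult_def poles_def Q_def)
qed

lemma finite_poles [simp]: "finite (poles f)"
  by (simp add: poles_eq_roots poly_roots_finite)

lemma denom_factorization:
  "snd (quot_of_fract f) =
     smult (lead_coeff (snd (quot_of_fract f))) (\<Prod>a\<in>poles f. [:- a, 1:] ^ pole_mult f a)"
  (is "?Q = smult _ ?R")
proof -
  have "?R = (\<Prod>a | poly ?Q a = 0. [:- a, 1:] ^ order a ?Q)"
    by (rule prod.cong) (auto simp: poles_eq_roots pole_mult_eq_order)
  thus ?thesis using complex_poly_decompose[of ?Q] by simp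
qed

lemma poly_denom:
  "poly (snd (quot_of_fract f)) z =
     lead_coeff (snd (quot_of_fract f)) * (\<Prod>a\<in>poles f. (z - a) ^ pole_mult f a)"
  by (subst denom_factorization) (simp add: poly_prod poly_power)

lemma poly_reflect_denom:
  "poly (reflect_poly (snd (quot_of_fract f))) w =
     lead_coeff (snd (quot_of_fract f)) * (\<Prod>a\<in>poles f. (1 - a * w) ^ pole_mult f a)"
proof -
  have "reflect_poly [:- a, 1:] = [:1, - a:]" for a :: complex
    by (simp add: reflect_poly_def cCons_def)
  thus ?thesis
    by (subst denom_factorization)
      (simp add: reflect_poly_smult reflect_poly_prod reflect_poly_power poly_prod poly_power mult.commute)
qed

lemma rat_eval_inverse:
  assumes "w \<noteq> 0"
  shows "rat_eval f (1 / w) =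
     w ^ degree (snd (quot_of_fract f)) * poly (reflect_poly (fst (quot_of_fract f))) w
      / (w ^ degree (fst (quot_of_fract f)) * poly (reflect_poly (snd (quot_of_fract f))) w)"
  using assms by (simp add: rat_eval_def poly_reflect_poly_nz inverse_eq_divide)

lemma analytic_on_poly [analytic_intros]: "poly (q :: complex poly) analytic_on S"
proof -
  have "(\<lambda>z. poly q z) holomorphic_on UNIV" by (intro holomorphic_intros)
  thus ?thesis by (auto simp: analytic_on_holomorphic)
qed

lemma rat_eval_analytic_circle:
  assumes "f \<in> rational_functions n"
  shows "rat_eval f analytic_on sphere 0 1"
  unfolding rat_eval_def[abs_def]
  by (intro analytic_intros) (use rational_functions_denom_nonzero_circle[OF assms] in auto)

lemma circle_no_poles:
  assumes "f \<in> rational_functions n" "a \<in> poles f"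
  shows "norm a \<noteq> 1"
  using rational_functions_denom_nonzero_circle[OF assms(1), of a] assms(2)
  by (auto simp: poles_eq_roots)

text \<open>
  The factors of the denominator that belong to poles inside the disc cancel against the
  numerators of the Blaschke factors. The explicit quotient that remains has its poles outside.
\<close>

lemma poles_inside_cancel:
  assumes "f \<in> rational_functions n"
  defines "I \<equiv> {a \<in> poles f. norm a < 1}"
  obtains g where "g analytic_on cball 0 1"
    "\<And>z. norm z = 1 \<Longrightarrow>
       eventually (\<lambda>\<zeta>. g \<zeta> = rat_eval f \<zeta> * blaschke I (pole_mult f) (\<lambda>a. a) \<zeta>) (nhds z)"
proof -
  define E where "E = {a \<in> poles f. norm a > 1}"
  define c where "c = lead_coeff (snd (quot_of_fract f))"
  define m where "m = pole_mult f"
  have c: "c \<noteq> 0" by (simp add: c_def)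
  have split: "poles f = I \<union> E" "I \<inter> E = {}" "finite I" "finite E"
    using circle_no_poles[OF assms(1)] finite_poles[of f]
    by (auto simp: I_def E_def not_less_iff_gr_or_eq intro: finite_subset)
  define g where "g = (\<lambda>\<zeta>. poly (fst (quot_of_fract f)) \<zeta>
    / (c * (\<Prod>a\<in>E. (\<zeta> - a) ^ m a) * (\<Prod>a\<in>I. (1 - cnj a * \<zeta>) ^ m a)))"
  have "g analytic_on cball 0 1"
    unfolding g_def
    by (intro analytic_intros)
      (use c split one_minus_cnj_mult_neq_0 in \<open>auto simp: I_def E_def\<close>)
  moreover have "eventually (\<lambda>\<zeta>. g \<zeta> = rat_eval f \<zeta> * blaschke I m (\<lambda>a. a) \<zeta>) (nhds z)"
    if z: "norm z = 1" for z
  proof -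
    have "open (- I)"
      using split by (intro open_Compl finite_imp_closed)
    moreover have "z \<in> - I"
      using z by (auto simp: I_def)
    ultimately have "eventually (\<lambda>\<zeta>. \<zeta> \<in> - I) (nhds z)" by (rule eventually_nhds_in_open)
    thus ?thesis
    proof eventually_elim
      case (elim \<zeta>)
      have "(\<Prod>a\<in>I. (\<zeta> - a) ^ m a) \<noteq> 0" using elim split by auto
      moreover have "poly (snd (quot_of_fract f)) \<zeta>
          = c * ((\<Prod>a\<in>I. (\<zeta> - a) ^ m a) * (\<Prod>a\<in>E. (\<zeta> - a) ^ m a))"
        unfolding poly_denom c_def[symmetric] m_def[symmetric] split(1)
        using split by (subst prod.union_disjoint) auto
      moreover have "blaschke I m (\<lambda>a. a) \<zeta> = (\<Prod>a\<in>I. (\<zeta> - a) ^ m a) / (\<Prod>a\<in>I. (1 - cnj a * \<zeta>) ^ m a)"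
        by (simp add: blaschke_def power_divide prod_dividef)
      ultimately show ?case by (simp add: g_def rat_eval_def)
    qed
  qed
  ultimately show ?thesis using that by (simp add: m_def)
qed

text \<open>
  The same for \<open>f (1 / w)\<close>, whose poles in the disc are the \<open>1 / a\<close> for outside poles \<open>a\<close>, and \<open>0\<close> with
  the multiplicity of the pole at infinity. The index \<open>0\<close> stands for the pole at infinity: it is not
  itself an outside pole, and \<open>1 / cnj 0 = 0\<close> is already the right zero.
\<close>

lemma poles_outside_cancel:
  assumes "f \<in> rational_functions n"
  defines "J \<equiv> insert 0 {a \<in> poles f. norm a > 1}"
    and "m \<equiv> \<lambda>a. if a = 0 then pole_mult_infinity f else pole_mult f a"
  obtains g where "g analytic_on cball 0 1"
    "\<And>v. norm v = 1 \<Longrightarrow>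
       eventually (\<lambda>w. g w = rat_eval f (1 / w) * blaschke J m (\<lambda>a. cnj (1 / cnj a)) w) (nhds v)"
proof -
  define I where "I = {a \<in> poles f. norm a < 1}"
  define E where "E = {a \<in> poles f. norm a > 1}"
  define P where "P = fst (quot_of_fract f)"
  define Q where "Q = snd (quot_of_fract f)"
  define c where "c = lead_coeff Q"
  have c: "c \<noteq> 0" by (simp add: c_def Q_def)
  have split: "poles f = I \<union> E" "I \<inter> E = {}" "finite I" "finite E" "0 \<notin> E"
    using circle_no_poles[OF assms(1)] finite_poles[of f]
    by (auto simp: I_def E_def not_less_iff_gr_or_eq intro: finite_subset)
  have deg: "degree P \<le> degree Q + pole_mult_infinity f"
    by (simp add: pole_mult_infinity_def P_def Q_def)
  define Z where "Z = (\<lambda>w. \<Prod>a\<in>E. (- a * (1 - w / cnj a)) ^ pole_mult f a)"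
  define X where "X = (\<lambda>w. \<Prod>a\<in>I. (1 - a * w) ^ pole_mult f a)"
  define Y where "Y = (\<lambda>w. \<Prod>a\<in>E. (1 - a * w) ^ pole_mult f a)"
  define g where "g = (\<lambda>w. w ^ (degree Q + pole_mult_infinity f - degree P) * poly (reflect_poly P) w
    / (c * X w * Z w))"
  have nz_I: "1 - a * w \<noteq> 0" if "a \<in> I" "norm w \<le> 1" for a w
    using one_minus_cnj_mult_neq_0[of "cnj a" w] that by (simp add: I_def)
  have nz_O: "a \<noteq> 0" "1 - w / cnj a \<noteq> 0" if "a \<in> E" "norm w \<le> 1" for a w
    using one_minus_cnj_mult_neq_0[of "1 / a" w] that by (auto simp: E_def norm_divide)
  have "g analytic_on cball 0 1"
    unfolding g_def X_def Z_def
    by (intro analytic_intros) (use c split nz_I nz_O in auto)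
  moreover have "eventually (\<lambda>w. g w = rat_eval f (1 / w) * blaschke J m (\<lambda>a. cnj (1 / cnj a)) w) (nhds v)"
    if v: "norm v = 1" for v
  proof -
    have "open (- insert 0 ((\<lambda>a. 1 / a) ` E))" "v \<in> - insert 0 ((\<lambda>a. 1 / a) ` E)"
      using split v by (auto simp: E_def norm_divide intro!: finite_imp_closed)
    hence "eventually (\<lambda>w. w \<in> - insert 0 ((\<lambda>a. 1 / a) ` E)) (nhds v)"
      by (rule eventually_nhds_in_open)
    thus ?thesis
    proof eventually_elim
      case (elim w)
      have w: "w \<noteq> 0" using elim by simp
      have w': "1 - a * w \<noteq> 0" if "a \<in> E" for a
      proof
        assume "1 - a * w = 0"
        hence "w = 1 / a" by (simp add: eq_divide_eq mult.commute) (use w in auto)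
        thus False using elim that by blast
      qed
      have Y: "Y w \<noteq> 0" unfolding Y_def using w' split by auto
      have Q: "poly (reflect_poly Q) w = c * (X w * Y w)"
        unfolding Q_def poly_reflect_denom c_def X_def Y_def split(1)
        using split by (subst prod.union_disjoint) auto
      have "blaschke J m (\<lambda>a. cnj (1 / cnj a)) w
          = w ^ pole_mult_infinity f * (\<Prod>a\<in>E. ((w - 1 / a) / (1 - w / cnj a)) ^ pole_mult f a)"
      proof -
        have "(\<Prod>a\<in>E. ((w - 1 / a) / (1 - w / cnj a)) ^ m a)
            = (\<Prod>a\<in>E. ((w - 1 / a) / (1 - w / cnj a)) ^ pole_mult f a)"
        proof (rule prod.cong[OF refl])
          fix a assume "a \<in> E"
          hence "a \<noteq> 0" using split by auto
          thus "((w - 1 / a) / (1 - w / cnj a)) ^ m a = ((w - 1 / a) / (1 - w / cnj a)) ^ pole_mult f a"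
            by (simp add: m_def)
        qed
        thus ?thesis
          unfolding blaschke_def J_def E_def[symmetric] using split
          by (simp add: m_def)
      qed
      also have "(\<Prod>a\<in>E. ((w - 1 / a) / (1 - w / cnj a)) ^ pole_mult f a) = Y w / Z w"
        unfolding Y_def Z_def prod_dividef[symmetric]
      proof (rule prod.cong[OF refl])
        fix a assume "a \<in> E"
        hence "a \<noteq> 0" using split by auto
        hence "w - 1 / a = (1 - a * w) / (- a)" by (simp add: field_simps)
        thus "((w - 1 / a) / (1 - w / cnj a)) ^ pole_mult f a
            = (1 - a * w) ^ pole_mult f a / (- a * (1 - w / cnj a)) ^ pole_mult f a"
          by (simp only: power_divide[symmetric] divide_divide_eq_left)
      qed
      finally have B: "blaschke J m (\<lambda>a. cnj (1 / cnj a)) w = w ^ pole_mult_infinity f * (Y w / Z w)" .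
      have pow: "w ^ degree Q * w ^ pole_mult_infinity f / w ^ degree P
          = w ^ (degree Q + pole_mult_infinity f - degree P)"
        using w deg by (simp add: power_diff power_add)
      have "rat_eval f (1 / w) * blaschke J m (\<lambda>a. cnj (1 / cnj a)) w
          = (w ^ degree Q * w ^ pole_mult_infinity f / w ^ degree P) * poly (reflect_poly P) w
              * (Y w / (c * (X w * Y w) * Z w))"
        unfolding rat_eval_inverse[OF w] B P_def[symmetric] Q_def[symmetric] Q
        by (simp only: divide_inverse inverse_mult_distrib mult_ac)
      also have "Y w / (c * (X w * Y w) * Z w) = 1 / (c * X w * Z w)"
        using Y by simp
      finally show ?case unfolding pow by (simp add: g_def)
    qed
  qed
  ultimately show ?thesis using that by blast
qed

lemma Lp_norm_1: "Lp_norm 1 g = (\<integral>\<zeta>. norm (g \<zeta>) \<partial>circle_measure)"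
  by (simp add: Lp_norm_def)

section \<open>The inequality for rational functions\<close>

theorem theorem2p2:
  fixes p :: ereal and n n1 n2 :: nat and f :: "complex poly fract"
  assumes "1 \<le> p"
    and "n \<ge> 1"
    and "f \<in> rational_functions n"
    and "num_poles_inside f = n1"
    and "num_poles_outside f = n2"
  shows "Lp_norm 1 (deriv (rat_eval f))
    \<le> ((if n1 = 0 then 0
         else real n1 powr (1 - real_of_ereal (1 / p)) * D1 f powr real_of_ereal (1 / p))
      + (if n2 = 0 then 0
         else real n2 powr (1 - real_of_ereal (1 / p)) * D2 f powr real_of_ereal (1 / p)))
      * Lp_norm p (rat_eval f)"
proof -
  define I where "I = {a \<in> poles f. norm a < 1}"
  define E where "E = {a \<in> poles f. norm a > 1}"
  define J where "J = insert 0 E"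
  define m where "m = (\<lambda>a. if a = 0 then pole_mult_infinity f else pole_mult f a)"
  have E: "finite E" "0 \<notin> E" by (auto simp: E_def)
  obtain g1 where g1: "g1 analytic_on cball 0 1"
    "\<And>z. norm z = 1 \<Longrightarrow>
       eventually (\<lambda>\<zeta>. g1 \<zeta> = rat_eval f \<zeta> * blaschke I (pole_mult f) (\<lambda>a. a) \<zeta>) (nhds z)"
    using poles_inside_cancel[OF assms(3)] unfolding I_def by blast
  obtain g2 where g2: "g2 analytic_on cball 0 1"
    "\<And>v. norm v = 1 \<Longrightarrow>
       eventually (\<lambda>w. g2 w = rat_eval f (1 / w) * blaschke J m (\<lambda>a. cnj (1 / cnj a)) w) (nhds v)"
    using poles_outside_cancel[OF assms(3)] unfolding J_def E_def m_def by blast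
  have in_disc: "norm a < 1" if "a \<in> I" for a using that by (simp add: I_def)
  have in_disc': "norm (1 / cnj a) < 1" if "a \<in> J" for a
    using that by (auto simp: J_def E_def norm_divide divide_less_eq)
  have f_cont: "continuous_on (sphere 0 1) (rat_eval f)"
    by (intro holomorphic_on_imp_continuous_on analytic_imp_holomorphic rat_eval_analytic_circle[OF assms(3)])
  note sum_J = sum.insert[OF E, folded J_def]
  have n1: "(\<Sum>a\<in>I. pole_mult f a) = n1"
    using assms(4) by (simp add: num_poles_inside_def I_def)
  have n2: "(\<Sum>a\<in>J. m a) = n2"
  proof -
    have "(\<Sum>a\<in>E. m a) = (\<Sum>a\<in>E. pole_mult f a)"
      by (rule sum.cong) (use E in \<open>auto simp: m_def\<close>)
    thus ?thesis using assms(5) by (simp add: sum_J num_poles_outside_def E_def m_def)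
  qed
  have D1: "(\<Sum>a\<in>I. real (pole_mult f a) * ((1 + norm a) / (1 - norm a))) = D1 f"
    by (simp add: D1_def I_def)
  have D2: "(\<Sum>a\<in>J. real (m a) * ((1 + norm (1 / cnj a)) / (1 - norm (1 / cnj a)))) = D2 f"
  proof -
    have "(\<Sum>a\<in>E. real (m a) * ((1 + norm (1 / cnj a)) / (1 - norm (1 / cnj a))))
        = (\<Sum>a\<in>E. real (pole_mult f a) * ((norm a + 1) / (norm a - 1)))"
    proof (rule sum.cong[OF refl])
      fix a assume "a \<in> E"
      hence a: "norm a > 1" "a \<noteq> 0" by (auto simp: E_def)
      have "(1 + 1 / norm a) / (1 - 1 / norm a) = (norm a + 1) / (norm a - 1)"
        using a by (simp add: divide_simps)
      thus "real (m a) * ((1 + norm (1 / cnj a)) / (1 - norm (1 / cnj a)))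
          = real (pole_mult f a) * ((norm a + 1) / (norm a - 1))"
        using a by (simp add: m_def norm_divide)
    qed
    thus ?thesis by (simp add: sum_J D2_def E_def m_def)
  qed
  have "Lp_norm 1 (deriv (rat_eval f))
      \<le> (\<integral>\<zeta>. norm (rat_eval f \<zeta>) * poisson_sum I (pole_mult f) (\<lambda>a. a) \<zeta> \<partial>circle_measure)
       + (\<integral>\<zeta>. norm (rat_eval f \<zeta>) * poisson_sum J m (\<lambda>a. 1 / cnj a) \<zeta> \<partial>circle_measure)"
    unfolding Lp_norm_1
    by (rule L1_deriv_le_poisson_integral[OF in_disc in_disc' rat_eval_analytic_circle[OF assms(3)]
          g1(1) g2(1) g1(2) g2(2)])
  also have "\<dots> \<le> (if n1 = 0 then 0
         else real n1 powr (1 - real_of_ereal (1 / p)) * D1 f powr real_of_ereal (1 / p))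
       * Lp_norm p (rat_eval f)
     + (if n2 = 0 then 0
         else real n2 powr (1 - real_of_ereal (1 / p)) * D2 f powr real_of_ereal (1 / p))
       * Lp_norm p (rat_eval f)"
  proof (rule add_mono)
    have "finite I" by (simp add: I_def)
    from poisson_integral_le_Lp_norm[where \<alpha> = "\<lambda>a. a" and m = "pole_mult f",
        OF in_disc this f_cont assms(1)]
    show "(\<integral>\<zeta>. norm (rat_eval f \<zeta>) * poisson_sum I (pole_mult f) (\<lambda>a. a) \<zeta> \<partial>circle_measure)
      \<le> (if n1 = 0 then 0
         else real n1 powr (1 - real_of_ereal (1 / p)) * D1 f powr real_of_ereal (1 / p))
       * Lp_norm p (rat_eval f)"
      unfolding n1 D1 by simp
    have "finite J" using E by (simp add: J_def)
    from poisson_integral_le_Lp_norm[where \<alpha> = "\<lambda>a. 1 / cnj a" and m = m,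
        OF in_disc' this f_cont assms(1)]
    show "(\<integral>\<zeta>. norm (rat_eval f \<zeta>) * poisson_sum J m (\<lambda>a. 1 / cnj a) \<zeta> \<partial>circle_measure)
      \<le> (if n2 = 0 then 0
         else real n2 powr (1 - real_of_ereal (1 / p)) * D2 f powr real_of_ereal (1 / p))
       * Lp_norm p (rat_eval f)"
      unfolding n2 D2 by simp
  qed
  finally show ?thesis by (simp add: distrib_right)
qed

end
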